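(* Let $0<\epsilon<1$ and let $B=(b_n)_{n\ge1}$ be an $\epsilon$-friendly sequence. Then there is a sequence $A=(a_n)_{n\ge1}$ of positive integers that interlaces $B$, i.e. $b_n\le a_n<b_{n+1}$ for all $n$, and which is $\epsilon$-complete.
   Context: For a sequence $B=(b_n)_{n\ge1}$, $\Delta b_n=b_{n+1}-b_n$ and $B(x)$ denotes the number of terms of $B$ that are at most $x$. A sequence $B$ of positive integers is $\epsilon$-friendly if: (i) for some constant $C$ and all $n$, $b_n\le\sum_{i\le\epsilon n+C}b_i$; (ii) $\lim_{n\to\infty}\Delta b_n=\infty$; (iii) $\lim_{i\to\infty}\frac{B(2^{i+1})-B(2^i)}{i}=\infty$; (iv) there exists $0<c<1$ such that $c\Delta b_i\le\Delta b_j$ for all $i<j$, and moreover if $b_j<2b_i$ then $\Delta b_j\le\frac1c\Delta b_i$; (v) $B$ is strictly increasing. For a sequence $A$ of positive integers, $\Sigma(A)$ is the set of sums of distinct terms of $A$; $A$ is complete if every sufficiently large positive integer lies in $\Sigma(A)$; $A$ is $\epsilon$-complete if every subsequence $A'$ of $A$ with $|A'\cap[n]|\ge\epsilon|A\cap[n]|$ for all sufficiently large $n$ is complete. *)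

theory Defs
  imports "HOL-Analysis.Analysis"
begin

(* Sequences are functions nat => nat, indexed from 1 (the value at index 0 is ignored). *)

definition Dlt :: "(nat \<Rightarrow> nat) \<Rightarrow> nat \<Rightarrow> real" where
  "Dlt b n = real (b (Suc n)) - real (b n)"

definition cnt :: "(nat \<Rightarrow> nat) \<Rightarrow> nat \<Rightarrow> nat" where
  "cnt b x = card {n. 1 \<le> n \<and> b n \<le> x}"

definition eps_friendly :: "real \<Rightarrow> (nat \<Rightarrow> nat) \<Rightarrow> bool" where
  "eps_friendly \<epsilon> b \<longleftrightarrow>
     (\<forall>n\<ge>1. b n > 0) \<and>
     (\<exists>C::real. \<forall>n\<ge>1. real (b n) \<le> (\<Sum>i\<in>{i. 1 \<le> i \<and> real i \<le> \<epsilon> * real n + C}. real (b i))) \<and>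
     filterlim (Dlt b) at_top sequentially \<and>
     filterlim (\<lambda>i::nat. (real (cnt b (2^(i+1))) - real (cnt b (2^i))) / real i) at_top sequentially \<and>
     (\<exists>c::real. 0 < c \<and> c < 1 \<and>
        (\<forall>i j. 1 \<le> i \<longrightarrow> i < j \<longrightarrow>
           c * Dlt b i \<le> Dlt b j \<and> (b j < 2 * b i \<longrightarrow> Dlt b j \<le> Dlt b i / c))) \<and>
     (\<forall>n\<ge>1. b n < b (Suc n))"

(* Sigma(A') for the subsequence of a given by an index set S of positive indices:
   sums of terms with distinct indices *)
definition subset_sums :: "(nat \<Rightarrow> nat) \<Rightarrow> nat set \<Rightarrow> nat set" where
  "subset_sums a S = {sum a F | F. finite F \<and> F \<subseteq> S}"

definition complete_sub :: "(nat \<Rightarrow> nat) \<Rightarrow> nat set \<Rightarrow> bool" where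
  "complete_sub a S \<longleftrightarrow> (\<forall>\<^sub>F m in sequentially. m \<in> subset_sums a S)"

definition eps_complete :: "real \<Rightarrow> (nat \<Rightarrow> nat) \<Rightarrow> bool" where
  "eps_complete \<epsilon> a \<longleftrightarrow>
     (\<forall>S. S \<subseteq> {1..} \<longrightarrow>
        (\<forall>\<^sub>F n in sequentially.
           real (card {i\<in>S. a i \<le> n}) \<ge> \<epsilon> * real (card {i. 1 \<le> i \<and> a i \<le> n}))
        \<longrightarrow> complete_sub a S)"

end

theory Submission
  imports Defs "HOL-Number_Theory.Cong"
begin

text \<open>
  Condition (iii) allows \<open>a\<close> to be chosen block by block, a block being the indices \<open>n\<close> with
  \<open>2^i < b n \<le> 2^(i+1)\<close>. Put \<open>a n = 1 + D * c n\<close> with \<open>D = k!\<close> and \<open>c n\<close> in a window of \<open>k\<close> consecutive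
  integers, \<open>k\<close> a constant. A counting argument shows that the \<open>c n\<close> can be chosen so that every subset
  of positive density of a late block contains two sets of equal size \<open>O(i)\<close> whose \<open>c\<close>-sums differ by
  some \<open>d\<close> with \<open>1 \<le> d \<le> k\<close>: otherwise the sums of half of the elements of a small set \<open>W\<close> grow
  exponentially until almost all remaining values are determined by those on \<open>W\<close>. Many disjoint such
  pairs with the same \<open>d\<close> give arbitrarily long progressions of difference \<open>D^2\<close> among the subset sums.

  Given a dense index set \<open>S\<close>, take such a progression from a finite set \<open>F\<close> in one block, and finitely
  many further terms whose sums cover all residues modulo \<open>D^2\<close> (all \<open>a n\<close> are coprime to \<open>D\<close>). It remains
  that the subset sums of the rest of \<open>S\<close> have bounded gaps, which holds greedily if each term is at most
  a constant plus the sum of the previous ones. Condition (i) gives this up to a bounded number of terms.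
  After thinning, \<open>S\<close> misses a positive proportion of the indices infinitely often; as the
  missing terms are replaced by larger ones, this makes up for the bounded loss and for the
  terms used in \<open>F\<close>, if \<open>F\<close> is placed in a suitable block.
\<close>

section \<open>Choosing the terms in one block\<close>

text \<open>Only subsets of one size are compared: in sums of \<open>a n = 1 + D * c n\<close> the
  ones then cancel, and \<open>a\<close>-sums differ by \<open>D\<close> times the difference of the
  \<open>c\<close>-sums.\<close>

definition hsums :: "('a \<Rightarrow> nat) \<Rightarrow> 'a set \<Rightarrow> nat \<Rightarrow> nat set" where
  "hsums c W h = {sum c A | A. A \<subseteq> W \<and> card A = h}"

lemma hsums_cong: "(\<And>n. n \<in> W \<Longrightarrow> c n = d n) \<Longrightarrow> hsums c W h = hsums d W h"
  unfolding hsums_def by (metis (no_types, lifting) subsetD sum.cong)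

lemma hsums_bound:
  assumes "finite W" "\<And>n. n \<in> W \<Longrightarrow> c n \<le> M"
  shows "hsums c W h \<subseteq> {..h * M}"
proof
  fix x assume "x \<in> hsums c W h"
  then obtain A where A: "x = sum c A" "A \<subseteq> W" "card A = h" unfolding hsums_def by blast
  have "sum c A \<le> of_nat (card A) * M"
    by (rule sum_bounded_above) (use A assms in auto)
  then show "x \<in> {..h * M}" using A by simp
qed

lemma finite_hsums: "finite W \<Longrightarrow> finite (hsums c W h)"
proof -
  assume "finite W"
  then have "finite (sum c ` Pow W)" by simp
  then show ?thesis by (rule finite_subset[rotated]) (auto simp: hsums_def)
qed

lemma hsums_insert:
  assumes "finite W" "u \<in> V" "u \<notin> W" "W \<subseteq> V"
  shows "(+) (c u) ` hsums c W h \<subseteq> hsums c V (Suc h)"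
proof
  fix x assume "x \<in> (+) (c u) ` hsums c W h"
  then obtain A where A: "x = c u + sum c A" "A \<subseteq> W" "card A = h" unfolding hsums_def by blast
  have "finite A" "u \<notin> A" using A assms finite_subset by auto
  then have "x = sum c (insert u A)" "card (insert u A) = Suc h" "insert u A \<subseteq> V"
    using A assms by auto
  then show "x \<in> hsums c V (Suc h)" unfolding hsums_def by blast
qed

section \<open>Counting the choices without close sums\<close>

definition separated :: "nat \<Rightarrow> nat set \<Rightarrow> bool" where
  "separated k X \<longleftrightarrow> (\<forall>x\<in>X. \<forall>y\<in>X. \<not> (y < x \<and> x \<le> y + k))"

text \<open>The translates of \<open>X\<close> by \<open>z\<close> and \<open>y\<close> share more
  than half of their elements, written without division. Otherwise their union is at least 3/2 times
  as large as \<open>X\<close>, the growth factor used below.\<close>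

definition stuck :: "nat set \<Rightarrow> nat \<Rightarrow> nat \<Rightarrow> bool" where
  "stuck X y z \<longleftrightarrow> 2 * card ((+) z ` X \<union> (+) y ` X) < 3 * card X"

text \<open>The translates by \<open>z\<close> and \<open>z'\<close> both meet the translate by
  \<open>y\<close> in more than half of it, so they share an element \<open>z + x = z' + x'\<close>.
  As \<open>z\<close> and \<open>z'\<close> differ by less than \<open>k\<close>, so do
  \<open>x\<close> and \<open>x'\<close>, and separation forces equality.\<close>

lemma stuck_unique:
  assumes X: "finite X" "separated k X" and "stuck X y z" "stuck X y z'"
    and "z \<in> {q..<q + k}" "z' \<in> {q..<q + k}"
  shows "z = z'"
proof (rule ccontr)
  assume ne: "z \<noteq> z'"
  have inter: "2 * card ((+) w ` X \<inter> (+) y ` X) > card X" if "stuck X y w" for w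
  proof -
    have "card ((+) w ` X) + card ((+) y ` X) =
        card ((+) w ` X \<union> (+) y ` X) + card ((+) w ` X \<inter> (+) y ` X)"
      using X by (intro card_Un_Int) auto
    moreover have "card ((+) w ` X) = card X" "card ((+) y ` X) = card X"
      by (simp_all add: card_image)
    ultimately show ?thesis using that unfolding stuck_def by linarith
  qed
  let ?A = "(+) z ` X \<inter> (+) y ` X" and ?B = "(+) z' ` X \<inter> (+) y ` X"
  have "?A \<inter> ?B \<noteq> {}"
  proof
    assume "?A \<inter> ?B = {}"
    then have "card (?A \<union> ?B) = card ?A + card ?B" using X by (intro card_Un_disjoint) auto
    moreover have "card (?A \<union> ?B) \<le> card ((+) y ` X)" using X by (intro card_mono) auto
    moreover have "card ((+) y ` X) = card X" by (simp add: card_image)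
    ultimately show False using inter[OF assms(3)] inter[OF assms(4)] by linarith
  qed
  then obtain x x' where "x \<in> X" "x' \<in> X" "z + x = z' + x'" by auto
  then have "\<not> (x' < x \<and> x \<le> x' + k)" "\<not> (x < x' \<and> x' \<le> x + k)" "z + x = z' + x'"
    using X(2) unfolding separated_def by auto
  then show False using assms(5,6) ne by auto
qed

text \<open>A triple \<open>(W, u, Q)\<close> records why a choice fails: the values on \<open>W\<close> and at \<open>u\<close> then
  determine the values on \<open>Q\<close>.\<close>

definition fails :: "nat \<Rightarrow> 'a set \<Rightarrow> ('a \<Rightarrow> nat set) \<Rightarrow> 'a set \<times> 'a \<times> 'a set \<Rightarrow> ('a \<Rightarrow> nat) set" where
  "fails k I V = (\<lambda>(W, u, Q). {c \<in> Pi\<^sub>E I V. separated k (hsums c W (card W div 2)) \<and>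
     (\<forall>n\<in>Q. stuck (hsums c W (card W div 2)) (c u) (c n))})"

text \<open>Restriction to \<open>I - Q\<close> is injective on the failing choices: it keeps the
  values on \<open>W\<close> and at \<open>u\<close>, and by \<open>stuck_unique\<close> these leave
  one possible value at each index of \<open>Q\<close>.\<close>

lemma card_fails:
  assumes I: "finite I" "W \<subseteq> I" "u \<in> I" "Q \<subseteq> I" "Q \<inter> insert u W = {}"
    and V: "\<And>n. V n = {q n..<q n + k}"
  shows "card (fails k I V (W, u, Q)) \<le> k ^ (card I - card Q)"
proof -
  let ?r = "\<lambda>c. restrict c (I - Q)"
  have "inj_on ?r (fails k I V (W, u, Q))"
  proof (rule inj_onI)
    fix c d assume c: "c \<in> fails k I V (W, u, Q)" and d: "d \<in> fails k I V (W, u, Q)" and eq: "?r c = ?r d"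
    have out: "c n = d n" if "n \<in> I - Q" for n using eq that by (metis restrict_apply')
    have W: "hsums c W h = hsums d W h" for h
      by (rule hsums_cong) (use I out in auto)
    have "c u = d u" using out I by auto
    have PiE: "c \<in> Pi\<^sub>E I V" "d \<in> Pi\<^sub>E I V" using c d unfolding fails_def by auto
    have "c n = d n" if "n \<in> Q" for n
    proof (rule stuck_unique)
      show "finite (hsums c W (card W div 2))" using I finite_hsums finite_subset by blast
      show "separated k (hsums c W (card W div 2))" "stuck (hsums c W (card W div 2)) (c u) (c n)"
        "stuck (hsums c W (card W div 2)) (c u) (d n)"
        using c d that W \<open>c u = d u\<close> unfolding fails_def by auto
      show "c n \<in> {q n..<q n + k}" "d n \<in> {q n..<q n + k}"
        using PiE that I V by (metis PiE_mem subsetD)+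
    qed
    then show "c = d" using out PiE by (metis PiE_ext Diff_iff)
  qed
  then have "card (fails k I V (W, u, Q)) = card (?r ` fails k I V (W, u, Q))" by (simp add: card_image)
  also have "\<dots> \<le> card (Pi\<^sub>E (I - Q) V)"
    by (intro card_mono finite_PiE) (use I in \<open>auto simp: V fails_def\<close>)
  also have "\<dots> = k ^ (card I - card Q)"
    using I by (simp add: card_PiE V card_Diff_subset finite_subset)
  finally show ?thesis .
qed

text \<open>Union bound: since \<open>k = 9 ^ L\<close> and \<open>Q\<close> has at least
  \<open>N / L\<close> elements, each triple spoils at most a fraction \<open>1 / 9 ^ N\<close> of
  the \<open>k ^ N\<close> choices, and there are at most \<open>8 ^ N\<close> triples.\<close>

lemma exists_spread_choice:
  fixes q :: "'a \<Rightarrow> nat"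
  assumes I: "finite I" "I \<noteq> {}" and M: "\<And>n. n \<in> I \<Longrightarrow> q n + 9 ^ L \<le> M"
    and h: "2 ^ h * (h * M + 1) < 3 ^ h"
  shows "\<exists>c. (\<forall>n\<in>I. q n \<le> c n \<and> c n < q n + 9 ^ L) \<and>
    (\<forall>U\<subseteq>I. card I \<le> L * (card U - (2 * h + 1)) \<longrightarrow>
      (\<exists>X\<subseteq>U. \<exists>Y\<subseteq>U. card X = card Y \<and> card X \<le> h \<and> sum c Y < sum c X \<and> sum c X \<le> sum c Y + 9 ^ L))"
proof -
  define k :: nat where "k = 9 ^ L"
  define V where "V n = {q n..<q n + k}" for n
  define N where "N = card I"
  have "N > 0" using I unfolding N_def by (simp add: card_gt_0_iff)
  define T where "T = {(W, u, Q). W \<subseteq> I \<and> u \<in> I \<and> Q \<subseteq> I \<and> Q \<inter> insert u W = {} \<and> N \<le> L * card Q}"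
  have Tsub: "T \<subseteq> Pow I \<times> I \<times> Pow I" unfolding T_def by auto
  have finT: "finite T" using Tsub by (rule finite_subset) (use I in auto)
  have "card T \<le> card (Pow I \<times> I \<times> Pow I)" by (rule card_mono[OF _ Tsub]) (use I in auto)
  also have "\<dots> = 2 ^ N * (N * 2 ^ N)" by (simp add: card_cartesian_product card_Pow I N_def)
  also have "\<dots> \<le> 2 ^ N * (2 ^ N * 2 ^ N)" using less_exp[of N] by (intro mult_le_mono) auto
  also have "\<dots> = (8::nat) ^ N" by (simp flip: power_mult_distrib)
  finally have cardT: "card T \<le> 8 ^ N" .
  have each: "card (fails k I V t) * 9 ^ N \<le> k ^ N" if "t \<in> T" for t
  proof -
    obtain W u Q where t: "t = (W, u, Q)" by (cases t)
    have *: "W \<subseteq> I" "u \<in> I" "Q \<subseteq> I" "Q \<inter> insert u W = {}" "N \<le> L * card Q" using that unfolding t T_def by auto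
    have "(9::nat) ^ N \<le> 9 ^ (L * card Q)" using * by (intro power_increasing) auto
    also have "\<dots> = k ^ card Q" by (simp add: k_def power_mult)
    finally have "card (fails k I V t) * 9 ^ N \<le> k ^ (card I - card Q) * k ^ card Q"
      unfolding t by (intro mult_le_mono card_fails I *) (simp add: V_def)
    also have "\<dots> = k ^ N" using * I by (simp add: N_def card_mono flip: power_add)
    finally show ?thesis .
  qed
  have "card (\<Union>t\<in>T. fails k I V t) * 9 ^ N \<le> (\<Sum>t\<in>T. card (fails k I V t)) * 9 ^ N"
    by (intro mult_le_mono card_UN_le finT) auto
  also have "\<dots> = (\<Sum>t\<in>T. card (fails k I V t) * 9 ^ N)" by (simp add: sum_distrib_right)
  also have "\<dots> \<le> of_nat (card T) * k ^ N" by (rule sum_bounded_above) (use each in auto)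
  also have "\<dots> \<le> 8 ^ N * k ^ N" using cardT by simp
  also have "\<dots> < k ^ N * 9 ^ N"
    using \<open>N > 0\<close> by (simp add: k_def power_strict_mono)
  finally have "card (\<Union>t\<in>T. fails k I V t) < k ^ N" by simp
  moreover have "card (Pi\<^sub>E I V) = k ^ N" using I by (simp add: card_PiE V_def N_def)
  moreover have "finite (\<Union>t\<in>T. fails k I V t)"
  proof (rule finite_subset)
    show "(\<Union>t\<in>T. fails k I V t) \<subseteq> Pi\<^sub>E I V" unfolding fails_def by auto
    show "finite (Pi\<^sub>E I V)" using I by (intro finite_PiE) (auto simp: V_def)
  qed
  ultimately have "\<not> Pi\<^sub>E I V \<subseteq> (\<Union>t\<in>T. fails k I V t)" by (metis card_mono linorder_not_less)
  then obtain c where c: "c \<in> Pi\<^sub>E I V" and cT: "\<And>t. t \<in> T \<Longrightarrow> c \<notin> fails k I V t" by blast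
  have cV: "q n \<le> c n \<and> c n < q n + k" if "n \<in> I" for n using PiE_mem[OF c that] by (simp add: V_def)
  have "\<exists>X\<subseteq>U. \<exists>Y\<subseteq>U. card X = card Y \<and> card X \<le> h \<and> sum c Y < sum c X \<and> sum c X \<le> sum c Y + k"
    if U: "U \<subseteq> I" "N \<le> L * (card U - (2 * h + 1))" for U
  proof (rule ccontr)
    assume neg: "\<not> ?thesis"
    have finU: "finite U" using U I finite_subset by blast
    have sep: "separated k (hsums c W g)" if "W \<subseteq> U" "g \<le> h" for W g
      unfolding separated_def hsums_def using neg that by clarsimp
    \<comment> \<open>The half sums of \<open>W\<close> number at least \<open>(3/2) ^ g\<close>. A
      maximal such \<open>g\<close> stays below \<open>h\<close>, because sums of \<open>h\<close>
      values at most \<open>M\<close> lie among \<open>h * M + 1\<close> integers.\<close>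
    define P where "P g \<longleftrightarrow> g \<le> h \<and> (\<exists>W\<subseteq>U. card W = 2 * g \<and> 3 ^ g \<le> 2 ^ g * card (hsums c W g))" for g
    have "{A::'a set. A = {}} = {{}}" by auto
    then have "P 0" unfolding P_def hsums_def by (auto intro!: exI[of _ "{}"] simp: card_eq_0_iff)
    moreover have Pb: "P g \<Longrightarrow> g \<le> h" for g unfolding P_def by simp
    ultimately obtain g where g: "P g" "\<And>g'. P g' \<Longrightarrow> g' \<le> g"
      by (metis GreatestI_nat Greatest_le_nat)
    then obtain W where W: "W \<subseteq> U" "card W = 2 * g" "3 ^ g \<le> 2 ^ g * card (hsums c W g)" and "g \<le> h"
      unfolding P_def by blast
    let ?X = "hsums c W g"
    have finW: "finite W" using W finU finite_subset by blast
    have "card ?X \<le> card {..g * M}"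
    proof (intro card_mono hsums_bound finW)
      fix n assume "n \<in> W"
      then have "n \<in> I" using W U by blast
      then show "c n \<le> M" using cV[of n] M[of n] unfolding k_def by linarith
    qed auto
    then have "2 ^ g * card ?X \<le> 2 ^ g * (g * M + 1)" by (intro mult_le_mono) auto
    then have "g \<noteq> h" using W(3) h by auto
    then have "g < h" using \<open>g \<le> h\<close> by simp
    have cardU: "card U > 2 * h + 1" using U(2) \<open>N > 0\<close> by (cases "card U - (2 * h + 1) = 0") auto
    then have "\<not> U \<subseteq> W" using W(2) \<open>g < h\<close> finW card_mono[of W U] by auto
    then obtain u where u: "u \<in> U" "u \<notin> W" by blast
    define Q where "Q = U - insert u W"
    have cardQ: "card Q = card U - (2 * g + 1)"
      unfolding Q_def using finW u W by (subst card_Diff_subset) auto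
    have "(W, u, Q) \<in> T"
    proof -
      have "L * (card U - (2 * h + 1)) \<le> L * card Q" unfolding cardQ using \<open>g < h\<close> by (intro mult_le_mono2) linarith
      then have "N \<le> L * card Q" using U(2) by linarith
      moreover have "W \<subseteq> I" "u \<in> I" "Q \<subseteq> I" "Q \<inter> insert u W = {}" using W u U unfolding Q_def by auto
      ultimately show ?thesis unfolding T_def by blast
    qed
    moreover have "c \<in> fails k I V (W, u, Q)"
    proof -
      \<comment> \<open>If \<open>n\<close> were not stuck, adjoining \<open>u\<close> and
        \<open>n\<close> to \<open>W\<close> would multiply the number of half sums by at least 3/2,
        against the maximality of \<open>g\<close>.\<close>
      have "stuck ?X (c u) (c n)" if "n \<in> Q" for n
      proof (rule ccontr)
        assume ns: "\<not> stuck ?X (c u) (c n)"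
        let ?W = "insert n (insert u W)"
        have n: "n \<in> U" "n \<notin> W" "n \<noteq> u" using that unfolding Q_def by auto
        have "(+) (c n) ` ?X \<union> (+) (c u) ` ?X \<subseteq> hsums c ?W (Suc g)"
          using n u finW by (intro Un_least hsums_insert) auto
        then have "card ((+) (c n) ` ?X \<union> (+) (c u) ` ?X) \<le> card (hsums c ?W (Suc g))"
          using finW by (intro card_mono finite_hsums) auto
        then have "3 * card ?X \<le> 2 * card (hsums c ?W (Suc g))" using ns unfolding stuck_def by linarith
        then have "2 ^ g * (3 * card ?X) \<le> 2 ^ g * (2 * card (hsums c ?W (Suc g)))" by (rule mult_le_mono2)
        moreover have "3 ^ Suc g \<le> 2 ^ g * (3 * card ?X)" using W(3) by simp
        moreover have "2 ^ g * (2 * card (hsums c ?W (Suc g))) = 2 ^ Suc g * card (hsums c ?W (Suc g))" by simp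
        ultimately have "3 ^ Suc g \<le> 2 ^ Suc g * card (hsums c ?W (Suc g))" by linarith
        moreover have "card ?W = 2 * Suc g" using n u finW W by auto
        ultimately have "P (Suc g)" unfolding P_def using \<open>g < h\<close> n u W by (auto intro!: exI[of _ ?W])
        then show False using g(2) by fastforce
      qed
      then show ?thesis using c sep[OF W(1) \<open>g \<le> h\<close>] W(2) unfolding fails_def by auto
    qed
    ultimately show False using cT by blast
  qed
  then show ?thesis using cV unfolding k_def N_def by blast
qed

section \<open>Progressions from disjoint pairs with a common difference\<close>

lemma disjoint_families:
  assumes "finite U" and "\<And>V. V \<subseteq> U \<Longrightarrow> t \<le> card V \<Longrightarrow> \<exists>X\<subseteq>V. \<exists>Y\<subseteq>V. card X \<le> h \<and> card Y \<le> h \<and> P X Y"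
    and "t + R * (2 * h) \<le> card U"
  shows "\<exists>X Y. (\<forall>j<R. X j \<subseteq> U \<and> Y j \<subseteq> U \<and> card (X j) \<le> h \<and> card (Y j) \<le> h \<and> P (X j) (Y j)) \<and>
     (\<forall>i<R. \<forall>j<R. i \<noteq> j \<longrightarrow> (X i \<union> Y i) \<inter> (X j \<union> Y j) = {})"
  using assms(3)
proof (induction R)
  case 0
  then show ?case by auto
next
  case (Suc R)
  then have "t + R * (2 * h) \<le> card U" by simp
  from Suc.IH[OF this] obtain X Y where XY: "\<forall>j<R. X j \<subseteq> U \<and> Y j \<subseteq> U \<and> card (X j) \<le> h \<and> card (Y j) \<le> h \<and> P (X j) (Y j)"
    and disj: "\<forall>i<R. \<forall>j<R. i \<noteq> j \<longrightarrow> (X i \<union> Y i) \<inter> (X j \<union> Y j) = {}" by blast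
  note XY = XY[rule_format] and disj = disj[rule_format]
  let ?F = "\<Union>j<R. X j \<union> Y j"
  have FU: "?F \<subseteq> U" using XY by blast
  have "card ?F \<le> (\<Sum>j<R. card (X j \<union> Y j))" by (rule card_UN_le) auto
  also have "\<dots> \<le> (\<Sum>j<R. 2 * h)"
  proof (rule sum_mono)
    fix j assume "j \<in> {..<R}"
    then show "card (X j \<union> Y j) \<le> 2 * h" using XY[of j] card_Un_le[of "X j" "Y j"] by auto
  qed
  \<comment> \<open>The pairs found so far use at most \<open>2 * h\<close> indices each, so at
    least \<open>t\<close> indices remain and yield another pair.\<close>
  finally have "card ?F \<le> R * (2 * h)" by simp
  moreover have "card (U - ?F) = card U - card ?F"
    by (intro card_Diff_subset finite_subset[OF FU assms(1)] FU)
  ultimately have "t \<le> card (U - ?F)" using Suc.prems by auto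
  then obtain X' Y' where new: "X' \<subseteq> U - ?F" "Y' \<subseteq> U - ?F" "card X' \<le> h" "card Y' \<le> h" "P X' Y'"
    using assms(2)[of "U - ?F"] by auto
  let ?X = "X(R := X')" and ?Y = "Y(R := Y')"
  have "\<forall>j<Suc R. ?X j \<subseteq> U \<and> ?Y j \<subseteq> U \<and> card (?X j) \<le> h \<and> card (?Y j) \<le> h \<and> P (?X j) (?Y j)"
    using XY new by (auto simp: less_Suc_eq)
  moreover have "(X' \<union> Y') \<inter> (X j \<union> Y j) = {}" if "j < R" for j using new that by blast
  then have "\<forall>i<Suc R. \<forall>j<Suc R. i \<noteq> j \<longrightarrow> (?X i \<union> ?Y i) \<inter> (?X j \<union> ?Y j) = {}"
    using disj by (auto simp: less_Suc_eq)
  ultimately show ?case by blast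
qed

text \<open>By pigeonhole, \<open>g * fact k\<close> of the disjoint pairs have the same
  \<open>d\<close>. The factorial is a common multiple of all possible \<open>d\<close>: with
  \<open>fact k = d * e\<close>, exchanging \<open>Y j\<close> for \<open>X j\<close> in
  \<open>l * e\<close> of the pairs adds
  \<open>l * e * fact k * d = l * (fact k)\<^sup>2\<close>.\<close>

lemma exists_progression:
  fixes a :: "nat \<Rightarrow> nat"
  assumes "finite U" "k > 0"
    and conf: "\<And>V. V \<subseteq> U \<Longrightarrow> t \<le> card V \<Longrightarrow>
      \<exists>X\<subseteq>V. \<exists>Y\<subseteq>V. card X \<le> h \<and> card Y \<le> h \<and> (\<exists>d\<in>{1..k}. sum a X = sum a Y + fact k * d)"
    and card: "t + (k * (g * fact k)) * (2 * h) \<le> card U"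
  shows "\<exists>F\<subseteq>U. card F \<le> (k * (g * fact k)) * (2 * h) \<and> (\<exists>z. \<forall>l\<le>g. z + l * (fact k)\<^sup>2 \<in> subset_sums a F)"
proof -
  define M R where "M = g * (fact k :: nat)" and "R = k * M"
  define P where "P X Y \<longleftrightarrow> (\<exists>d\<in>{1..k}. sum a X = sum a Y + fact k * d)" for X Y
  have "\<exists>X Y. (\<forall>j<R. X j \<subseteq> U \<and> Y j \<subseteq> U \<and> card (X j) \<le> h \<and> card (Y j) \<le> h \<and> P (X j) (Y j)) \<and>
     (\<forall>i<R. \<forall>j<R. i \<noteq> j \<longrightarrow> (X i \<union> Y i) \<inter> (X j \<union> Y j) = {})"
    by (rule disjoint_families[OF assms(1) conf[folded P_def] card[folded M_def R_def]]) auto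
  then obtain X Y where XY: "\<forall>j<R. X j \<subseteq> U \<and> Y j \<subseteq> U \<and> card (X j) \<le> h \<and> card (Y j) \<le> h \<and> P (X j) (Y j)"
    and disj: "\<forall>i<R. \<forall>j<R. i \<noteq> j \<longrightarrow> (X i \<union> Y i) \<inter> (X j \<union> Y j) = {}" by blast
  note XY = XY[rule_format] and disj = disj[rule_format]
  obtain f where f: "\<And>j. j < R \<Longrightarrow> f j \<in> {1..k} \<and> sum a (X j) = sum a (Y j) + fact k * f j"
    using XY unfolding P_def by metis
  have "\<exists>d\<in>{1..k}. card {..<R} \<le> card (f -` {d} \<inter> {..<R}) * card {1..k}"
    by (rule pigeonhole_card) (use f \<open>k > 0\<close> in auto)
  then obtain d where d: "d \<in> {1..k}" "M \<le> card (f -` {d} \<inter> {..<R})"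
    using \<open>k > 0\<close> by (auto simp: R_def)
  then obtain J where J: "J \<subseteq> f -` {d} \<inter> {..<R}" "card J = M" "finite J"
    by (metis obtain_subset_with_card_n)
  have JR: "j < R \<and> f j = d" if "j \<in> J" for j using J that by auto
  have finX: "finite (X j)" "finite (Y j)" if "j \<in> J" for j
    using XY[of j] JR[OF that] assms(1) finite_subset by auto
  define F where "F = (\<Union>j\<in>J. X j \<union> Y j)"
  have "F \<subseteq> U" unfolding F_def using XY JR by blast
  moreover have "card F \<le> R * (2 * h)"
  proof -
    have "card F \<le> (\<Sum>j\<in>J. card (X j \<union> Y j))" unfolding F_def by (rule card_UN_le) (rule J)
    also have "\<dots> \<le> of_nat (card J) * (2 * h)"
    proof (rule sum_bounded_above)
      fix j assume "j \<in> J"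
      then show "card (X j \<union> Y j) \<le> 2 * h" using XY[of j] JR card_Un_le[of "X j" "Y j"] by fastforce
    qed
    also have "\<dots> \<le> R * (2 * h)" using J(2) \<open>k > 0\<close> by (simp add: R_def)
    finally show ?thesis .
  qed
  moreover have "(\<Sum>j\<in>J. sum a (Y j)) + l * (fact k)\<^sup>2 \<in> subset_sums a F" if "l \<le> g" for l
  proof -
    have "d dvd fact k" using d(1) by (intro dvd_fact) auto
    then obtain e where e: "fact k = d * e" by blast
    have "l * e \<le> g * fact k" using that d(1) unfolding e by (intro mult_le_mono) auto
    then obtain T where T: "T \<subseteq> J" "card T = l * e" "finite T"
      using J(2) unfolding M_def by (metis obtain_subset_with_card_n)
    define G where "G j = (if j \<in> T then X j else Y j)" for j
    have "sum a (\<Union>j\<in>J. G j) = (\<Sum>j\<in>J. sum a (G j))"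
    proof (rule sum.UNION_disjoint)
      show "\<forall>i\<in>J. \<forall>j\<in>J. i \<noteq> j \<longrightarrow> G i \<inter> G j = {}"
        using disj JR unfolding G_def by (simp add: Int_Un_distrib Int_Un_distrib2)
    qed (use J finX in \<open>auto simp: G_def\<close>)
    also have "\<dots> = (\<Sum>j\<in>J. sum a (Y j) + (if j \<in> T then fact k * d else 0))"
      using f JR by (intro sum.cong) (auto simp: G_def)
    also have "\<dots> = (\<Sum>j\<in>J. sum a (Y j)) + card T * (fact k * d)"
      using J T by (simp add: sum.distrib sum.If_cases Int_absorb1)
    also have "card T * (fact k * d) = l * (fact k)\<^sup>2" unfolding T(2) by (simp add: e power2_eq_square)
    finally have "(\<Sum>j\<in>J. sum a (Y j)) + l * (fact k)\<^sup>2 = sum a (\<Union>j\<in>J. G j)" by simp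
    moreover have "(\<Union>j\<in>J. G j) \<subseteq> F" unfolding F_def G_def by auto
    moreover have "finite (\<Union>j\<in>J. G j)" using J finX by (auto simp: G_def)
    ultimately show ?thesis unfolding subset_sums_def by blast
  qed
  ultimately show ?thesis unfolding R_def M_def by blast
qed

text \<open>The subtracted terms pay for the indices used up by the disjoint pairs and for the set
  \<open>insert u W\<close> of the counting argument; what is left of \<open>U\<close> must still be
  a fraction \<open>1 / L\<close> of the block.\<close>

lemma exists_block_choice:
  fixes q :: "nat \<Rightarrow> nat" and L :: nat
  defines "k \<equiv> 9 ^ L"
  assumes I: "finite I" "I \<noteq> {}" and M: "\<And>n. n \<in> I \<Longrightarrow> q n + k \<le> M"
    and h: "2 ^ h * (h * M + 1) < 3 ^ h"
  shows "\<exists>c. (\<forall>n\<in>I. q n \<le> c n \<and> c n < q n + k) \<and>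
    (\<forall>a U g. (\<forall>n\<in>I. a n = 1 + fact k * c n) \<longrightarrow> U \<subseteq> I \<longrightarrow>
      card I \<le> L * (card U - k * (g * fact k) * (2 * h) - (2 * h + 1)) \<longrightarrow>
      (\<exists>F\<subseteq>U. card F \<le> k * (g * fact k) * (2 * h) \<and> (\<exists>z. \<forall>l\<le>g. z + l * (fact k)\<^sup>2 \<in> subset_sums a F)))"
proof -
  obtain c where c: "\<forall>n\<in>I. q n \<le> c n \<and> c n < q n + k"
    and conf: "\<And>U. U \<subseteq> I \<Longrightarrow> card I \<le> L * (card U - (2 * h + 1)) \<Longrightarrow>
      \<exists>X\<subseteq>U. \<exists>Y\<subseteq>U. card X = card Y \<and> card X \<le> h \<and> sum c Y < sum c X \<and> sum c X \<le> sum c Y + k"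
    using exists_spread_choice[of I q L M h] I M h unfolding k_def by blast
  have "\<exists>F\<subseteq>U. card F \<le> k * (g * fact k) * (2 * h) \<and> (\<exists>z. \<forall>l\<le>g. z + l * (fact k)\<^sup>2 \<in> subset_sums a F)"
    if a: "\<forall>n\<in>I. a n = 1 + fact k * c n" and U: "U \<subseteq> I"
      and cU: "card I \<le> L * (card U - k * (g * fact k) * (2 * h) - (2 * h + 1))" for a U g
  proof (rule exists_progression)
    show "finite U" using U I finite_subset by blast
    show "k > 0" unfolding k_def by simp
    have "card I > 0" using I by (simp add: card_gt_0_iff)
    \<comment> \<open>The differences are truncated; the hypothesis on \<open>card I > 0\<close>
      makes this one positive, so nothing is cut off.\<close>
    then have "card U - k * (g * fact k) * (2 * h) - (2 * h + 1) \<noteq> 0" using cU by (intro notI) auto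
    then show "card U - k * (g * fact k) * (2 * h) + k * (g * fact k) * (2 * h) \<le> card U" by linarith
    fix V assume V: "V \<subseteq> U" "card U - k * (g * fact k) * (2 * h) \<le> card V"
    have "card I \<le> L * (card V - (2 * h + 1))"
      using cU V(2) by (meson diff_le_mono le_trans mult_le_mono2)
    then obtain X Y where XY: "X \<subseteq> V" "Y \<subseteq> V" "card X = card Y" "card X \<le> h" "sum c Y < sum c X" "sum c X \<le> sum c Y + k"
      using conf[OF subset_trans[OF V(1) U]] by blast
    have s: "sum a Z = card Z + fact k * sum c Z" if "Z \<subseteq> V" for Z
    proof -
      have "sum a Z = (\<Sum>n\<in>Z. 1 + fact k * c n)" by (rule sum.cong) (use a that V U in auto)
      also have "\<dots> = card Z + fact k * sum c Z" by (subst sum.distrib) (simp add: sum_distrib_left)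
      finally show ?thesis .
    qed
    define d where "d = sum c X - sum c Y"
    have "d \<in> {1..k}" "sum c X = sum c Y + d" using XY unfolding d_def by auto
    then have "d \<in> {1..k} \<and> sum a X = sum a Y + fact k * d" using s[of X] s[of Y] XY by (simp add: algebra_simps)
    then show "\<exists>X\<subseteq>V. \<exists>Y\<subseteq>V. card X \<le> h \<and> card Y \<le> h \<and> (\<exists>d\<in>{1..k}. sum a X = sum a Y + fact k * d)"
      using XY by (intro exI[of _ X] conjI exI[of _ Y]) auto
  qed
  then show ?thesis using c by blast
qed

section \<open>Completeness from three parts\<close>

text \<open>The term \<open>a n\<close> is used exactly when \<open>x\<close> is out of reach of the
  earlier terms; the growth condition then gives \<open>a n \<le> x\<close>.\<close>

lemma greedy_subset_sum:
  fixes a :: "nat \<Rightarrow> nat"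
  assumes "\<And>n. n \<in> S \<Longrightarrow> a n \<le> g + sum a (S \<inter> {..<n})" and "x \<le> g + sum a (S \<inter> {..<n})"
  shows "\<exists>G\<subseteq>S \<inter> {..<n}. sum a G \<le> x \<and> x \<le> sum a G + g"
  using assms(2)
proof (induction n arbitrary: x)
  case 0
  then show ?case by (intro exI[of _ "{}"]) auto
next
  case (Suc n)
  have S: "S \<inter> {..<Suc n} = (if n \<in> S then insert n (S \<inter> {..<n}) else S \<inter> {..<n})"
    by (auto simp: less_Suc_eq)
  show ?case
  proof (cases "x \<le> g + sum a (S \<inter> {..<n})")
    case True
    from Suc.IH[OF this] show ?thesis unfolding S by (metis subset_insertI2)
  next
    case False
    then have n: "n \<in> S" using Suc.prems unfolding S by (auto split: if_splits)
    have le: "a n \<le> x" using False assms(1)[OF n] by simp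
    have "x - a n \<le> g + sum a (S \<inter> {..<n})" using Suc.prems n unfolding S by auto
    from Suc.IH[OF this] obtain G where G: "G \<subseteq> S \<inter> {..<n}" "sum a G \<le> x - a n" "x - a n \<le> sum a G + g" by blast
    have "finite G" "n \<notin> G" using G(1) finite_subset by auto
    then have "sum a (insert n G) = a n + sum a G" by simp
    then show ?thesis using G le n unfolding S by (intro exI[of _ "insert n G"]) auto
  qed
qed

lemma infinite_subset_sum_unbounded:
  fixes a :: "nat \<Rightarrow> nat"
  assumes "infinite S" "\<And>n. n \<in> S \<Longrightarrow> 0 < a n"
  shows "\<exists>n. x \<le> sum a (S \<inter> {..<n})"
proof -
  obtain T where T: "T \<subseteq> S" "finite T" "card T = x" using infinite_arbitrarily_large[OF assms(1)] by blast
  obtain n where n: "T \<subseteq> {..<n}" using T(2) finite_nat_bounded by blast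
  have "of_nat (card T) * 1 \<le> sum a T" by (rule sum_bounded_below) (use T assms(2) in \<open>auto simp: Suc_le_eq\<close>)
  also have "\<dots> \<le> sum a (S \<inter> {..<n})" by (rule sum_mono2) (use T n in auto)
  finally show ?thesis using T(3) by auto
qed

text \<open>\<open>S1\<close> approximates the target from below up to a bounded error,
  \<open>S2\<close> corrects the residue modulo \<open>m\<close>, and the bounded remainder
  \<open>l * m\<close> is supplied by the progression in \<open>F\<close>.\<close>

lemma complete_sub_from_parts:
  assumes sub: "S1 \<subseteq> S" "S2 \<subseteq> S" "F \<subseteq> S" and disj: "S1 \<inter> S2 = {}" "S1 \<inter> F = {}" "S2 \<inter> F = {}"
    and S1: "infinite S1" "\<And>n. n \<in> S1 \<Longrightarrow> 0 < a n" "\<And>n. n \<in> S1 \<Longrightarrow> a n \<le> g + sum a (S1 \<inter> {..<n})"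
    and S2: "finite S2" "\<And>r. \<exists>J\<subseteq>S2. [sum a J = r] (mod m)"
    and F: "\<And>l. l \<le> g + sum a S2 \<Longrightarrow> z + l * m \<in> subset_sums a F" and "m > 0"
  shows "complete_sub a S"
  unfolding complete_sub_def
proof (rule eventually_sequentiallyI)
  fix x assume x: "z + sum a S2 \<le> x"
  \<comment> \<open>Lowering the target by \<open>sum a S2\<close> leaves room for \<open>J\<close>,
    which is chosen only after \<open>G\<close>.\<close>
  let ?x = "x - z - sum a S2"
  obtain n where "?x \<le> sum a (S1 \<inter> {..<n})" using infinite_subset_sum_unbounded[of S1 a ?x] S1(1,2) by blast
  then obtain G where G: "G \<subseteq> S1 \<inter> {..<n}" "sum a G \<le> ?x" "?x \<le> sum a G + g"
    using greedy_subset_sum[of S1 a g ?x n] S1(3) by auto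
  obtain J where J: "J \<subseteq> S2" "[sum a J = x - z - sum a G] (mod m)" using S2(2) by blast
  have Jle: "sum a J \<le> sum a S2" by (rule sum_mono2) (use S2 J in auto)
  have "sum a J \<le> x - z - sum a G" using G(2) Jle x by linarith
  then have "m dvd (x - z - sum a G) - sum a J"
    using J(2) by (metis cong_altdef_nat cong_sym)
  then obtain l where l: "x - z - sum a G - sum a J = l * m" by (metis dvd_def mult.commute)
  have "l \<le> l * m" using \<open>m > 0\<close> by simp
  also have "\<dots> \<le> g + sum a S2" using l G by linarith
  finally obtain H where H: "finite H" "H \<subseteq> F" "z + l * m = sum a H"
    using F[of l] unfolding subset_sums_def by blast
  have fin: "finite G" "finite J" using G(1) J(1) S2(1) finite_subset by auto
  have "sum a (G \<union> J \<union> H) = sum a G + sum a J + sum a H"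
    using fin H disj G(1) J(1) by (subst sum.union_disjoint; (subst sum.union_disjoint)?) blast+
  also have "\<dots> = x" using l H(3) G(2) Jle x by linarith
  finally have "x = sum a (G \<union> J \<union> H)" by simp
  moreover have "G \<union> J \<union> H \<subseteq> S" "finite (G \<union> J \<union> H)" using G(1) J(1) H sub fin by auto
  ultimately show "x \<in> subset_sums a S" unfolding subset_sums_def by blast
qed

text \<open>Infinitely many terms share one residue modulo \<open>D\<^sup>2\<close>, a unit because
  the terms are 1 modulo \<open>D\<close>. Sums of fewer than \<open>D\<^sup>2\<close> of them run
  through all multiples of this unit, hence through all residues.\<close>

lemma exists_residue_cover:
  fixes a :: "nat \<Rightarrow> nat"
  assumes "infinite S" "\<And>n. n \<in> S \<Longrightarrow> [a n = 1] (mod D)" "D > 0"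
  shows "\<exists>T\<subseteq>S. finite T \<and> (\<forall>r. \<exists>J\<subseteq>T. [sum a J = r] (mod D\<^sup>2))"
proof -
  let ?m = "D\<^sup>2"
  have "finite ((\<lambda>n. a n mod ?m) ` S)"
    by (rule finite_subset[of _ "{..<?m}"]) (use assms(3) in auto)
  then obtain n0 where n0: "n0 \<in> S" "infinite {n \<in> S. a n mod ?m = a n0 mod ?m}"
    using pigeonhole_infinite[OF assms(1)] by blast
  obtain T where T: "T \<subseteq> {n \<in> S. a n mod ?m = a n0 mod ?m}" "finite T" "card T = ?m"
    using infinite_arbitrarily_large[OF n0(2)] by blast
  have "coprime (a n0) D" using assms(2)[OF n0(1)] by (metis cong_imp_coprime cong_sym coprime_1_left)
  then have "coprime (a n0) ?m" by simp
  then obtain x where x: "[a n0 * x = 1] (mod ?m)" using cong_solve_coprime_nat by fastforce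
  have "\<exists>J\<subseteq>T. [sum a J = r] (mod ?m)" for r
  proof -
    have "(x * r) mod ?m < ?m" using assms(3) by simp
    then obtain J where J: "J \<subseteq> T" "card J = (x * r) mod ?m" using T by (metis less_imp_le obtain_subset_with_card_n)
    have "[sum a J = (\<Sum>n\<in>J. a n0)] (mod ?m)" by (rule cong_sum) (use J T in \<open>auto simp: cong_def\<close>)
    also have "(\<Sum>n\<in>J. a n0) = a n0 * ((x * r) mod ?m)" using J by simp
    also have "[\<dots> = a n0 * (x * r)] (mod ?m)" by (simp add: cong_def mod_mult_right_eq)
    also have "a n0 * (x * r) = (a n0 * x) * r" by simp
    also have "[\<dots> = 1 * r] (mod ?m)" by (rule cong_scalar_right[OF x])
    finally show ?thesis using J by auto
  qed
  then show ?thesis using T by blast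
qed

section \<open>Rearranging and thinning index sets\<close>

text \<open>Serves to split the part of \<open>S\<close> in one block into a lower half, which
  provides surplus, and an upper half, which provides the progression.\<close>

lemma lower_part:
  fixes V :: "nat set"
  assumes "finite V" "e \<le> card V"
  shows "\<exists>E\<subseteq>V. card E = e \<and> (\<forall>x\<in>E. \<forall>y\<in>V - E. x < y)"
  using assms(2)
proof (induction e)
  case 0
  then show ?case by (intro exI[of _ "{}"]) auto
next
  case (Suc e)
  then obtain E where E: "E \<subseteq> V" "card E = e" "\<And>x y. x \<in> E \<Longrightarrow> y \<in> V - E \<Longrightarrow> x < y" by auto
  have fin: "finite E" "finite (V - E)" using E assms(1) finite_subset by auto
  have ne: "V - E \<noteq> {}" using E Suc.prems card_mono[OF fin(1), of V] by auto
  define y where "y = Min (V - E)"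
  have y: "y \<in> V - E" "\<And>z. z \<in> V - E \<Longrightarrow> y \<le> z" unfolding y_def using Min_in[OF fin(2) ne] fin by auto
  show ?case
  proof (intro exI[of _ "insert y E"] conjI ballI)
    fix x z assume "x \<in> insert y E" "z \<in> V - insert y E"
    then show "x < z" using E(3)[of x z] y(2)[of z] by (cases "x = y") auto
  qed (use E y fin in auto)
qed

text \<open>An \<open>m\<close>-element index set has at least the sum of the first \<open>m\<close> terms; the next two lemmas quantify the
  surplus coming from indices up to \<open>m\<close> that are skipped, and from indices beyond \<open>m\<close> that are used.\<close>

lemma sum_missing_small:
  fixes a :: "nat \<Rightarrow> nat"
  assumes mono: "\<And>i j. 1 \<le> i \<Longrightarrow> i \<le> j \<Longrightarrow> a i \<le> a j" and "1 \<le> m"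
    and P: "finite P" "P \<subseteq> {1..}" "card P = m"
    and M: "M \<subseteq> {1..m} - P" "\<And>j. j \<in> M \<Longrightarrow> a j \<le> x"
  shows "sum a {1..m} + card M * a m \<le> sum a P + card M * x"
proof -
  let ?R = "{1..m} - P"
  \<comment> \<open>As \<open>P\<close> has \<open>m\<close> elements, as many indices lie beyond
    \<open>m\<close> as are skipped up to \<open>m\<close>; both kinds are compared with
    \<open>a m\<close>.\<close>
  have "card (P - {1..m}) = card ?R"
    using P by (simp add: card_Diff_subset_Int Int_commute)
  moreover have "of_nat (card (P - {1..m})) * a m \<le> sum a (P - {1..m})"
    by (rule sum_bounded_below) (use mono P \<open>1 \<le> m\<close> in auto)
  moreover have "sum a P = sum a (P \<inter> {1..m}) + sum a (P - {1..m})" using P by (simp add: sum.Int_Diff)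
  ultimately have 1: "sum a (P \<inter> {1..m}) + card ?R * a m \<le> sum a P" by simp
  have fin: "finite M" using M(1) finite_subset by auto
  have "sum a {1..m} = sum a (P \<inter> {1..m}) + sum a ?R"
    by (metis Int_commute finite_atLeastAtMost sum.Int_Diff)
  moreover have "sum a ?R = sum a M + sum a (?R - M)"
    using M fin by (simp add: sum.subset_diff add.commute)
  moreover have "sum a M \<le> of_nat (card M) * x" by (rule sum_bounded_above) (rule M)
  moreover have "sum a (?R - M) \<le> of_nat (card (?R - M)) * a m"
    by (rule sum_bounded_above) (use mono in auto)
  moreover have "card (?R - M) + card M = card ?R"
    using M fin by (simp add: card_Diff_subset card_mono)
  then have "card (?R - M) * a m + card M * a m = card ?R * a m" by (metis add_mult_distrib)
  ultimately show ?thesis using 1 by simp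
qed

lemma sum_present_large:
  fixes a :: "nat \<Rightarrow> nat"
  assumes mono: "\<And>i j. 1 \<le> i \<Longrightarrow> i \<le> j \<Longrightarrow> a i \<le> a j" and "1 \<le> m"
    and P: "finite P" "P \<subseteq> {1..}" "card P = m"
    and E: "E \<subseteq> P - {1..m}" "\<And>j. j \<in> E \<Longrightarrow> y \<le> a j"
  shows "sum a {1..m} + card E * y \<le> sum a P + card E * a m"
proof -
  let ?R = "{1..m} - P"
  have cR: "card (P - {1..m}) = card ?R"
    using P by (simp add: card_Diff_subset_Int Int_commute)
  have fin: "finite E" using E(1) P(1) by (meson finite_Diff finite_subset)
  have "sum a (P - {1..m}) = sum a E + sum a (P - {1..m} - E)"
    using E fin P by (simp add: sum.subset_diff add.commute)
  moreover have "of_nat (card E) * y \<le> sum a E" by (rule sum_bounded_below) (rule E)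
  moreover have "of_nat (card (P - {1..m} - E)) * a m \<le> sum a (P - {1..m} - E)"
    by (rule sum_bounded_below) (use mono P \<open>1 \<le> m\<close> in auto)
  moreover have "card (P - {1..m} - E) + card E = card (P - {1..m})"
    using E fin P by (simp add: card_Diff_subset card_mono)
  then have "card (P - {1..m} - E) * a m + card E * a m = card ?R * a m" unfolding cR[symmetric] by (metis add_mult_distrib)
  moreover have "sum a P = sum a (P \<inter> {1..m}) + sum a (P - {1..m})" using P by (simp add: sum.Int_Diff)
  moreover have "sum a {1..m} = sum a (P \<inter> {1..m}) + sum a ?R"
    by (metis Int_commute finite_atLeastAtMost sum.Int_Diff)
  moreover have "sum a ?R \<le> of_nat (card ?R) * a m"
    by (rule sum_bounded_above) (use mono in auto)
  ultimately show ?thesis by simp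
qed

text \<open>If \<open>S\<close> itself misses too few indices, the multiples of a large \<open>p\<close> can be removed because \<open>\<epsilon> < 1\<close>.\<close>

lemma thin_subset:
  fixes \<epsilon> :: real
  assumes "\<epsilon> < 1" and large: "\<And>k. k0 \<le> k \<Longrightarrow> \<epsilon> * real k \<le> real (card (S \<inter> {1..k}))"
  shows "\<exists>T\<subseteq>S. \<exists>k1 t. (\<forall>k\<ge>k1. \<epsilon> * real k \<le> real (card (T \<inter> {1..k}))) \<and>
    (\<forall>n. \<exists>m\<ge>n. m \<le> t * card ({1..m} - T))"
proof -
  \<comment> \<open>Since \<open>2 / p \<le> 1 - \<epsilon>\<close>, one share \<open>1 / p\<close>
    can cover the indices missing from \<open>S\<close> and the other the multiples of
    \<open>p\<close> removed from it.\<close>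
  obtain p :: nat where p: "2 / (1 - \<epsilon>) < real p" using reals_Archimedean2 by blast
  have "0 < 2 / (1 - \<epsilon>)" using assms(1) by simp
  then have "p > 0" using p by (metis gr0I less_asym of_nat_0)
  have p2: "2 / real p \<le> 1 - \<epsilon>" using p assms(1) \<open>p > 0\<close> by (simp add: field_simps)
  show ?thesis
  proof (cases "\<forall>n. \<exists>m\<ge>n. m \<le> (2 * p) * card ({1..m} - S)")
    case True
    then show ?thesis using large by blast
  next
    case False
    then obtain N where N: "\<And>m. m \<ge> N \<Longrightarrow> (2 * p) * card ({1..m} - S) < m" by (meson not_le)
    define Q where "Q k = {j \<in> {1..k}. p dvd j}" for k
    have cardQ: "card (Q k) = k div p" for k
    proof -
      have "Q k = (*) p ` {1..k div p}"
      proof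
        show "Q k \<subseteq> (*) p ` {1..k div p}"
        proof
          fix j assume "j \<in> Q k"
          then obtain i where i: "j = p * i" "1 \<le> j" "j \<le> k" unfolding Q_def by auto
          then have "i \<in> {1..k div p}" using \<open>p > 0\<close> by (auto simp: less_eq_div_iff_mult_less_eq mult.commute Suc_le_eq)
          then show "j \<in> (*) p ` {1..k div p}" using i by blast
        qed
        show "(*) p ` {1..k div p} \<subseteq> Q k"
          using \<open>p > 0\<close> unfolding Q_def by (auto simp: less_eq_div_iff_mult_less_eq mult.commute)
      qed
      moreover have "inj_on ((*) p) {1..k div p}" using \<open>p > 0\<close> by (simp add: inj_on_def)
      ultimately show ?thesis by (simp add: card_image)
    qed
    define T where "T = S - {j. p dvd j}"
    have "\<epsilon> * real k \<le> real (card (T \<inter> {1..k}))" if "k \<ge> N" for k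
    proof -
      have "{1..k} \<subseteq> (T \<inter> {1..k}) \<union> (({1..k} - S) \<union> Q k)" unfolding T_def Q_def by auto
      then have "card {1..k} \<le> card ((T \<inter> {1..k}) \<union> (({1..k} - S) \<union> Q k))" by (intro card_mono) (auto simp: Q_def)
      also have "\<dots> \<le> card (T \<inter> {1..k}) + (card ({1..k} - S) + card (Q k))"
        by (meson add_left_mono card_Un_le order_trans)
      finally have "real k \<le> real (card (T \<inter> {1..k})) + real (card ({1..k} - S)) + real (k div p)" unfolding cardQ by simp
      moreover have "real (k div p) \<le> real k / real p" by (rule of_nat_div_le_of_nat)
      moreover have "real (card ({1..k} - S)) \<le> real k / real p"
      proof -
        have "card ({1..k} - S) * p \<le> (2 * p) * card ({1..k} - S)" by simp
        then have "card ({1..k} - S) * p \<le> k" using N[OF that] by linarith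
        then have "real (card ({1..k} - S)) * real p \<le> real k" by (metis of_nat_le_iff of_nat_mult)
        then show ?thesis using \<open>p > 0\<close> by (simp add: pos_le_divide_eq)
      qed
      moreover have "real k * (2 / real p) \<le> real k * (1 - \<epsilon>)" using p2 by (intro mult_left_mono) auto
      then have "2 * (real k / real p) \<le> real k - \<epsilon> * real k" by (simp add: algebra_simps)
      ultimately show ?thesis by linarith
    qed
    \<comment> \<open>At \<open>m = p * n\<close> the removed multiples of \<open>p\<close> alone
      are a fraction \<open>1 / p\<close> of the indices.\<close>
    moreover have "\<exists>m\<ge>n. m \<le> (2 * p) * card ({1..m} - T)" for n
    proof (intro exI[of _ "p * n"] conjI)
      show "n \<le> p * n" using \<open>p > 0\<close> by simp
      have "card (Q (p * n)) \<le> card ({1..p * n} - T)" by (intro card_mono) (auto simp: Q_def T_def)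
      then have "n \<le> card ({1..p * n} - T)" using cardQ[of "p * n"] \<open>p > 0\<close> by simp
      then have "p * n \<le> p * card ({1..p * n} - T)" by (rule mult_le_mono2)
      also have "\<dots> \<le> (2 * p) * card ({1..p * n} - T)" by simp
      finally show "p * n \<le> (2 * p) * card ({1..p * n} - T)" .
    qed
    ultimately show ?thesis unfolding T_def by blast
  qed
qed

text \<open>Validates the choice \<open>h = 8 * i\<close> and \<open>M = 2 ^ (i + 2)\<close>:
  \<open>3 ^ 8 = 6561\<close> exceeds \<open>2 ^ 8 * 4 = 1024\<close>, and from \<open>i = 2\<close>
  on this absorbs the factor 33.\<close>

lemma growth_inequality:
  fixes i :: nat
  assumes "2 \<le> i"
  shows "2 ^ (8 * i) * (8 * i * 2 ^ (i + 2) + 1) < (3::nat) ^ (8 * i)"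
proof -
  have "8 * i * 2 ^ (i + 2) + 1 \<le> 33 * (2 ^ i * 2 ^ i :: nat)"
  proof -
    have "i * 2 ^ i \<le> 2 ^ i * (2 ^ i :: nat)" using less_exp[of i] by (intro mult_le_mono1) simp
    moreover have "(1::nat) \<le> 2 ^ i * 2 ^ i" by simp
    moreover have "8 * i * 2 ^ (i + 2) + 1 = 32 * (i * 2 ^ i) + (1::nat)" by (simp add: power_add)
    ultimately show ?thesis by linarith
  qed
  also have "(2::nat) ^ i * 2 ^ i = 4 ^ i" by (simp flip: power_mult_distrib)
  finally have "2 ^ (8 * i) * (8 * i * 2 ^ (i + 2) + 1) \<le> 2 ^ (8 * i) * (33 * (4::nat) ^ i)"
    by (rule mult_le_mono2)
  also have "\<dots> = 33 * 1024 ^ i" by (simp add: power_mult flip: power_mult_distrib)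
  also have "\<dots> < 6561 ^ i"
  proof -
    obtain j where j: "i = 2 + j" using assms le_Suc_ex by blast
    have "(33 * 1024 ^ 2) * 1024 ^ j < (6561 ^ 2) * (6561::nat) ^ j"
      by (rule mult_less_le_imp_less) (auto intro: power_mono)
    then show ?thesis unfolding j power_add by simp
  qed
  also have "(6561::nat) ^ i = 3 ^ (8 * i)" by (simp add: power_mult)
  finally show ?thesis .
qed

section \<open>Friendly sequences\<close>

locale friendly_seq =
  fixes \<epsilon> :: real and b :: "nat \<Rightarrow> nat" and C :: real
  assumes eps: "0 < \<epsilon>" "\<epsilon> < 1"
    and pos: "\<And>n. 1 \<le> n \<Longrightarrow> 0 < b n"
    and step: "\<And>n. 1 \<le> n \<Longrightarrow> b n < b (Suc n)"
    and sums: "\<And>n. 1 \<le> n \<Longrightarrow> real (b n) \<le> (\<Sum>i\<in>{i. 1 \<le> i \<and> real i \<le> \<epsilon> * real n + C}. real (b i))"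
    and blocks: "filterlim (\<lambda>i::nat. (real (cnt b (2^(i+1))) - real (cnt b (2^i))) / real i) at_top sequentially"
begin

section \<open>Growth of the counting function at powers of two\<close>

definition beta :: "nat \<Rightarrow> nat" where
  "beta i = cnt b (2 ^ i)"

lemma b_less: "1 \<le> m \<Longrightarrow> m < n \<Longrightarrow> b m < b n"
proof (induction n)
  case (Suc n)
  then show ?case using step[of n] by (cases "m = n") auto
qed simp

lemma b_mono: "1 \<le> m \<Longrightarrow> m \<le> n \<Longrightarrow> b m \<le> b n"
  using b_less[of m n] by (cases "m = n") auto

lemma b_ge: "1 \<le> n \<Longrightarrow> n \<le> b n"
proof (induction n)
  case (Suc n)
  then show ?case using step[of n] pos[of 1] by (cases "n = 0") auto
qed simp

text \<open>As \<open>b\<close> increases, the counted indices form an initial segment; so block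
  \<open>i\<close> is the index interval from \<open>beta i + 1\<close> to
  \<open>beta (Suc i)\<close>.\<close>

lemma cnt_set: "{n. 1 \<le> n \<and> b n \<le> x} = {1..cnt b x}"
proof -
  let ?T = "{n. 1 \<le> n \<and> b n \<le> x}"
  have "?T \<subseteq> {1..x}" using b_ge order_trans by fastforce
  then have fin: "finite ?T" using finite_subset by blast
  show ?thesis
  proof (cases "?T = {}")
    case True
    then show ?thesis unfolding cnt_def by (metis card.empty atLeastatMost_empty_iff not_one_le_zero)
  next
    case False
    define p where "p = Max ?T"
    have p: "p \<in> ?T" "\<And>n. n \<in> ?T \<Longrightarrow> n \<le> p" unfolding p_def using Max_in[OF fin False] Max_ge[OF fin] by auto
    have "?T = {1..p}" using p b_mono order_trans by fastforce
    then show ?thesis unfolding cnt_def by simp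
  qed
qed

lemma b_le_iff: "1 \<le> n \<Longrightarrow> b n \<le> 2 ^ i \<longleftrightarrow> n \<le> beta i"
proof -
  assume "1 \<le> n"
  moreover have "n \<in> {n. 1 \<le> n \<and> b n \<le> 2 ^ i} \<longleftrightarrow> n \<in> {1..beta i}"
    unfolding beta_def by (simp only: cnt_set)
  ultimately show ?thesis by simp
qed

lemma beta_mono: "i \<le> j \<Longrightarrow> beta i \<le> beta j"
proof -
  assume "i \<le> j"
  then have "(2::nat) ^ i \<le> 2 ^ j" by simp
  then have "{n. 1 \<le> n \<and> b n \<le> 2 ^ i} \<subseteq> {n. 1 \<le> n \<and> b n \<le> 2 ^ j}"
    by (intro Collect_mono) (meson order_trans)
  then show ?thesis unfolding cnt_set beta_def by auto
qed

lemma beta_le: "beta i \<le> 2 ^ i"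
  using b_le_iff[of "beta i" i] b_ge[of "beta i"] by (cases "beta i = 0") auto

text \<open>Condition (iii) in the form used: blocks outgrow every fixed multiple of
  \<open>i\<close>, which is the order of the number of indices spent on a progression.\<close>

lemma beta_growth: "\<exists>i0\<ge>1. \<forall>i\<ge>i0. beta i + H * i \<le> beta (Suc i)"
proof -
  have "\<forall>\<^sub>F i in sequentially. real H \<le> (real (cnt b (2^(i+1))) - real (cnt b (2^i))) / real i"
    using blocks unfolding filterlim_at_top by blast
  then obtain i0 where i0: "\<And>i. i \<ge> i0 \<Longrightarrow> real H \<le> (real (beta (Suc i)) - real (beta i)) / real i"
    unfolding eventually_sequentially beta_def by auto
  have "beta i + H * i \<le> beta (Suc i)" if "i \<ge> max 1 i0" for i
  proof -
    have "real H * real i \<le> real (beta (Suc i)) - real (beta i)"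
      using i0[of i] that by (simp add: pos_le_divide_eq)
    then have "real (beta i + H * i) \<le> real (beta (Suc i))" by simp
    then show ?thesis by linarith
  qed
  then show ?thesis by (intro exI[of _ "max 1 i0"]) auto
qed

lemma beta_unbounded: "\<exists>i0. \<forall>i\<ge>i0. X \<le> beta i"
proof -
  have "b (Suc X) \<le> 2 ^ b (Suc X)" by (rule less_imp_le[OF less_exp])
  then have "Suc X \<le> beta (b (Suc X))" by (subst b_le_iff[symmetric]) auto
  then have "\<forall>i\<ge>b (Suc X). X \<le> beta i" using beta_mono by (meson Suc_leD le_trans)
  then show ?thesis by blast
qed

text \<open>Condition (i) for \<open>n\<close> about \<open>beta i / \<epsilon>\<close> bounds
  \<open>b n\<close> by a sum of at most \<open>beta i\<close> terms, each at most
  \<open>2 ^ i\<close>, hence by \<open>2 ^ (2 * i)\<close>; so \<open>n \<le> beta (2 * i)\<close>.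
  The ratio lies above \<open>\<epsilon>\<close> to absorb \<open>C\<close> and the
  rounding.\<close>

lemma beta_double: "\<exists>i0. \<forall>i\<ge>i0. real (beta i) \<le> (1 + \<epsilon>) / 2 * real (beta (2 * i))"
proof -
  define r where "r = (1 + \<epsilon>) / 2"
  have r: "0 < r" "\<epsilon> < r" unfolding r_def using eps by auto
  define w where "w = 1 / \<epsilon> - 1 / r"
  have "w > 0" unfolding w_def using r eps by (simp add: frac_less2)
  obtain X :: nat where X: "(C / \<epsilon> + 2) / w \<le> real X" using real_arch_simple by blast
  obtain i0 where i0: "\<And>i. i \<ge> i0 \<Longrightarrow> X \<le> beta i" using beta_unbounded by blast
  have "real (beta i) \<le> r * real (beta (2 * i))" if "i \<ge> i0" for i
  proof -
    define y where "y = (real (beta i) - C) / \<epsilon>"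
    have "(C / \<epsilon> + 2) / w \<le> real (beta i)" using X i0[OF that] by linarith
    then have "C / \<epsilon> + 2 \<le> real (beta i) * w" using \<open>w > 0\<close> by (simp add: pos_divide_le_eq)
    then have y: "real (beta i) / r + 2 \<le> y"
      unfolding y_def w_def by (simp add: diff_divide_distrib right_diff_distrib)
    have nn: "0 \<le> real (beta i) / r" using r by simp
    define n where "n = nat \<lfloor>y\<rfloor>"
    have n: "real n \<le> y" "y < real n + 1" "1 \<le> n" unfolding n_def using y nn by linarith+
    have "\<epsilon> * real n + C \<le> real (beta i)"
      using n(1) eps unfolding y_def by (simp add: field_simps)
    then have sub: "{j. 1 \<le> j \<and> real j \<le> \<epsilon> * real n + C} \<subseteq> {1..beta i}" by auto
    have "real (b n) \<le> (\<Sum>j\<in>{j. 1 \<le> j \<and> real j \<le> \<epsilon> * real n + C}. real (b j))" by (rule sums) (rule n)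
    also have "\<dots> \<le> (\<Sum>j\<in>{1..beta i}. real (b j))" by (rule sum_mono2) (use sub in auto)
    also have "\<dots> \<le> of_nat (card {1..beta i}) * 2 ^ i"
    proof (rule sum_bounded_above)
      fix j assume "j \<in> {1..beta i}"
      then have "b j \<le> 2 ^ i" using b_le_iff[of j i] by auto
      then show "real (b j) \<le> 2 ^ i" by (metis of_nat_le_iff of_nat_numeral of_nat_power)
    qed
    also have "\<dots> \<le> 2 ^ i * 2 ^ i"
      using beta_le[of i] by (simp add: mult_right_mono)
    also have "\<dots> = 2 ^ (2 * i)" by (simp add: mult_2 power_add)
    finally have "b n \<le> 2 ^ (2 * i)" by (metis of_nat_le_iff of_nat_numeral of_nat_power)
    then have "n \<le> beta (2 * i)" using b_le_iff n(3) by simp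
    then have "real (beta i) / r \<le> real (beta (2 * i))" using y n by linarith
    then show ?thesis using r by (simp add: field_simps)
  qed
  then show ?thesis unfolding r_def by blast
qed

text \<open>\<open>beta_double\<close> is iterated until the power of the ratio falls below
  \<open>\<epsilon> / 2\<close>.\<close>

lemma beta_multiple: "\<exists>s i0. \<forall>i\<ge>i0. real (beta i) \<le> \<epsilon> / 2 * real (beta (2 ^ s * i))"
proof -
  define r where "r = (1 + \<epsilon>) / 2"
  have r: "0 < r" "r < 1" unfolding r_def using eps by auto
  obtain i0 where i0: "\<And>i. i \<ge> i0 \<Longrightarrow> real (beta i) \<le> r * real (beta (2 * i))"
    using beta_double unfolding r_def by blast
  have iter: "real (beta i) \<le> r ^ s * real (beta (2 ^ s * i))" if "i \<ge> i0" for i s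
    using that
  proof (induction s arbitrary: i)
    case (Suc s)
    have "real (beta i) \<le> r * real (beta (2 * i))" using i0 Suc.prems by simp
    also have "\<dots> \<le> r * (r ^ s * real (beta (2 ^ s * (2 * i))))"
      using Suc.IH[of "2 * i"] Suc.prems r by (intro mult_left_mono) auto
    finally show ?case by (simp add: algebra_simps)
  qed simp
  obtain s where "r ^ s < \<epsilon> / 2" using real_arch_pow_inv[of "\<epsilon> / 2" r] r eps by auto
  then have "real (beta i) \<le> \<epsilon> / 2 * real (beta (2 ^ s * i))" if "i \<ge> i0" for i
    using iter[OF that, of s] by (smt (verit, best) mult_right_mono of_nat_0_le_iff)
  then show ?thesis by blast
qed

text \<open>Late dyadic blocks are nonempty, so the next term lies at most one block further on,
  which costs a factor of at most 4.\<close>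

lemma ratio_bound: "\<exists>n0\<ge>1. \<forall>n\<ge>n0. \<forall>t. b (n + t) \<le> 4 ^ t * b n"
proof -
  obtain i0 where i0: "i0 \<ge> 1" "\<And>i. i \<ge> i0 \<Longrightarrow> beta i + 1 * i \<le> beta (Suc i)" using beta_growth by blast
  define n0 :: nat where "n0 = 2 ^ i0"
  have one: "b (Suc n) \<le> 4 * b n" if "n \<ge> n0" for n
  proof -
    have n1: "1 \<le> n" using that unfolding n0_def by (metis le_trans one_le_power one_le_numeral)
    have bn: "b n \<ge> 2 ^ i0" using b_ge[OF n1] that unfolding n0_def by linarith
    obtain i where i: "2 ^ i \<le> b n" "b n < 2 ^ Suc i"
      using ex_power_ivl1[of 2 "b n"] pos[OF n1] by auto
    have "(2::nat) ^ i0 < 2 ^ Suc i" using i bn by linarith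
    then have "i0 \<le> i" by (simp add: power_strict_increasing_iff del: power_Suc)
    have "n \<le> beta (Suc i)" using b_le_iff[OF n1, of "Suc i"] i by auto
    also have "\<dots> < beta (Suc (Suc i))" using i0(2)[of "Suc i"] \<open>i0 \<le> i\<close> by auto
    finally have "b (Suc n) \<le> 2 ^ Suc (Suc i)" by (subst b_le_iff) auto
    then show ?thesis using i by simp
  qed
  have "b (n + t) \<le> 4 ^ t * b n" if "n \<ge> n0" for n t
  proof (induction t)
    case (Suc t)
    have "b (n + Suc t) \<le> 4 * b (n + t)" using one[of "n + t"] that by simp
    also have "\<dots> \<le> 4 * (4 ^ t * b n)" using Suc by simp
    finally show ?case by simp
  qed simp
  then show ?thesis by (intro exI[of _ n0]) (auto simp: n0_def)
qed

text \<open>Averaging: if all blocks from \<open>i\<close> to \<open>j\<close> had density below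
  \<open>\<epsilon> / 2\<close>, then even with all indices up to \<open>beta i\<close> in
  \<open>S\<close>, at most \<open>\<epsilon> / 2 * beta j\<close> many, the density up to
  \<open>beta j\<close> would be below \<open>\<epsilon>\<close>.\<close>

lemma exists_dense_block:
  assumes large: "\<And>k. k0 \<le> k \<Longrightarrow> \<epsilon> * real k \<le> real (card (S \<inter> {1..k}))"
    and ij: "i \<le> j" "k0 \<le> beta j" "0 < beta i" "real (beta i) \<le> \<epsilon> / 2 * real (beta j)"
  shows "\<exists>l. i \<le> l \<and> l < j \<and> \<epsilon> / 2 * real (beta (Suc l) - beta l) \<le> real (card (S \<inter> {beta l<..beta (Suc l)}))"
proof (rule ccontr)
  assume neg: "\<not> ?thesis"
  have "real (card (S \<inter> {beta i<..beta l})) \<le> \<epsilon> / 2 * (real (beta l) - real (beta i))" if "i \<le> l" "l \<le> j" for l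
    using that
  proof (induction l rule: dec_induct)
    case base
    then show ?case by simp
  next
    case (step l)
    have bm: "beta i \<le> beta l" "beta l \<le> beta (Suc l)" using step beta_mono by auto
    have "S \<inter> {beta i<..beta (Suc l)} = (S \<inter> {beta i<..beta l}) \<union> (S \<inter> {beta l<..beta (Suc l)})"
      using bm by auto
    then have "card (S \<inter> {beta i<..beta (Suc l)}) \<le> card (S \<inter> {beta i<..beta l}) + card (S \<inter> {beta l<..beta (Suc l)})"
      by (simp add: card_Un_le)
    moreover have "real (card (S \<inter> {beta l<..beta (Suc l)})) \<le> \<epsilon> / 2 * (real (beta (Suc l)) - real (beta l))"
    proof -
      have "\<not> \<epsilon> / 2 * real (beta (Suc l) - beta l) \<le> real (card (S \<inter> {beta l<..beta (Suc l)}))"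
        using neg step by auto
      then show ?thesis using bm(2) by (simp add: of_nat_diff)
    qed
    moreover have "real (card (S \<inter> {beta i<..beta l})) \<le> \<epsilon> / 2 * (real (beta l) - real (beta i))" using step by simp
    ultimately show ?case by (simp add: algebra_simps)
  qed
  from this[of j] have 1: "real (card (S \<inter> {beta i<..beta j})) \<le> \<epsilon> / 2 * (real (beta j) - real (beta i))" using ij by simp
  have "S \<inter> {1..beta j} \<subseteq> {1..beta i} \<union> (S \<inter> {beta i<..beta j})" by auto
  then have "card (S \<inter> {1..beta j}) \<le> card ({1..beta i} \<union> (S \<inter> {beta i<..beta j}))" by (intro card_mono) auto
  also have "\<dots> \<le> beta i + card (S \<inter> {beta i<..beta j})" using card_Un_le[of "{1..beta i}"] by simp
  finally have "real (card (S \<inter> {1..beta j})) \<le> real (beta i) + \<epsilon> / 2 * (real (beta j) - real (beta i))" using 1 by linarith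
  also have "\<dots> < \<epsilon> * real (beta j)"
  proof -
    have "0 < \<epsilon> * real (beta i)" using eps ij(3) by simp
    moreover have "\<epsilon> / 2 * (real (beta j) - real (beta i)) = \<epsilon> * real (beta j) / 2 - \<epsilon> * real (beta i) / 2"
      by (simp add: algebra_simps)
    ultimately show ?thesis using ij(4) by linarith
  qed
  finally show False using large[OF ij(2)] by simp
qed

section \<open>Surplus of partial sums over the next term\<close>

lemma interlace_mono:
  assumes "\<And>n. 1 \<le> n \<Longrightarrow> b n \<le> a n \<and> a n < b (Suc n)" "1 \<le> i" "i \<le> j"
  shows "a i \<le> a j"
proof (cases "i = j")
  case False
  then have "b (Suc i) \<le> b j" using assms by (intro b_mono) auto
  then show ?thesis using assms(1)[of i] assms(1)[of j] assms(2,3) by linarith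
qed simp

text \<open>In the application \<open>m\<close> is the number of chosen indices below
  \<open>n\<close>. Condition (i) at \<open>Suc n\<close> reaches at most
  \<open>nat \<lceil>C + 2\<rceil>\<close> indices beyond \<open>m\<close>, and each of those terms
  is at most a constant times \<open>a m\<close> by \<open>ratio\<close>.\<close>

lemma term_le_partial_sum:
  assumes inter: "\<And>n. 1 \<le> n \<Longrightarrow> b n \<le> a n \<and> a n < b (Suc n)"
    and ratio: "\<And>n t. n0 \<le> n \<Longrightarrow> b (n + t) \<le> 4 ^ t * b n" and "1 \<le> n0" "n0 \<le> m"
    and "1 \<le> n" "\<epsilon> * (real n - 1) \<le> real m"
  shows "a n \<le> sum a {1..m} + (nat \<lceil>C + 2\<rceil> * 4 ^ Suc (nat \<lceil>C + 2\<rceil>)) * a m"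
proof -
  define e where "e = nat \<lceil>C + 2\<rceil>"
  have e: "C + 2 \<le> real e" unfolding e_def by linarith
  have "\<epsilon> * real (Suc n) + C \<le> real m + 2 * \<epsilon> + C" using assms(6) by (simp add: algebra_simps)
  also have "\<dots> \<le> real (m + e)" using e eps by simp
  finally have sub: "{j. 1 \<le> j \<and> real j \<le> \<epsilon> * real (Suc n) + C} \<subseteq> {1..m + e}" by auto
  have "real (a n) \<le> real (b (Suc n))" using inter[of n] assms(5) by simp
  also have "\<dots> \<le> (\<Sum>j\<in>{j. 1 \<le> j \<and> real j \<le> \<epsilon> * real (Suc n) + C}. real (b j))" by (rule sums) simp
  also have "\<dots> \<le> (\<Sum>j\<in>{1..m + e}. real (b j))" by (rule sum_mono2) (use sub in auto)
  also have "\<dots> \<le> (\<Sum>j\<in>{1..m + e}. real (a j))" using inter by (intro sum_mono) auto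
  finally have "a n \<le> sum a {1..m + e}" by (simp flip: of_nat_sum)
  also have "{1..m + e} = {1..m} \<union> {m<..m + e}" by auto
  then have "sum a {1..m + e} = sum a {1..m} + sum a {m<..m + e}"
    by (simp only:) (rule sum.union_disjoint, auto)
  also have "sum a {m<..m + e} \<le> of_nat (card {m<..m + e}) * (4 ^ Suc e * a m)"
  proof (rule sum_bounded_above)
    fix j assume j: "j \<in> {m<..m + e}"
    then have "1 \<le> j" by simp
    then have "a j \<le> b (Suc j)" using inter[of j] by simp
    also have "\<dots> \<le> b (m + Suc e)" using j by (intro b_mono) auto
    also have "\<dots> \<le> 4 ^ Suc e * b m" using assms(4) by (rule ratio)
    also have "\<dots> \<le> 4 ^ Suc e * a m" using inter[of m] assms(3,4) by (intro mult_le_mono2) auto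
    finally show "a j \<le> 4 ^ Suc e * a m" .
  qed
  finally show ?thesis unfolding e_def by (simp add: algebra_simps)
qed

text \<open>The surplus \<open>K * i * 2 ^ i\<close> pays for deleting a set \<open>F\<close> inside
  \<open>U\<close> whose sum has this order; the deletion affects only those \<open>n\<close> that
  lie beyond some element of \<open>U\<close>.\<close>

lemma exists_slack_block:
  assumes inter: "\<And>n. 1 \<le> n \<Longrightarrow> b n \<le> a n \<and> a n < b (Suc n)"
    and S: "S \<subseteq> {1..}"
    and large: "\<And>k. k0 \<le> k \<Longrightarrow> \<epsilon> * real k \<le> real (card (S \<inter> {1..k}))"
    and missing: "\<And>n. \<exists>n0\<ge>n. n0 \<le> t * card ({1..n0} - S)"
  shows "\<exists>i\<ge>i1. \<exists>U\<subseteq>S \<inter> {beta i<..beta (Suc i)}. \<epsilon> / 4 * real (beta (Suc i) - beta i) \<le> real (card U) \<and>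
    (\<forall>n\<in>S. (\<exists>u\<in>U. u \<le> n) \<longrightarrow> a n + K * i * 2 ^ i \<le> sum a (S \<inter> {..<n}))"
proof -
  define Z where "Z = nat \<lceil>C + 2\<rceil> * (4::nat) ^ Suc (nat \<lceil>C + 2\<rceil>)"
  obtain nr where nr: "1 \<le> nr" "\<And>n t. nr \<le> n \<Longrightarrow> b (n + t) \<le> 4 ^ t * b n" using ratio_bound by blast
  obtain s ia where ia: "\<And>i. i \<ge> ia \<Longrightarrow> real (beta i) \<le> \<epsilon> / 2 * real (beta (2 ^ s * i))"
    using beta_multiple by blast
  obtain H1 :: nat where H1: "4 / \<epsilon> * real (Z + 2 * K + 1) \<le> real H1" using real_arch_simple by blast
  \<comment> \<open>The first summand makes the lower half \<open>E\<close> of the dense block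
    large, the second the set \<open>M\<close> of missing indices, although \<open>i\<close> may
    come close to \<open>3 * 2 ^ s * (i0 - 2)\<close>.\<close>
  define H where "H = H1 + 3 * t * (2 * Z + 4 * K) * 2 ^ s"
  obtain ib where ib: "\<And>i. i \<ge> ib \<Longrightarrow> beta i + H * i \<le> beta (Suc i)" using beta_growth by blast
  obtain ic where ic: "\<And>i. i \<ge> ic \<Longrightarrow> beta i + 1 * i \<le> beta (Suc i)" using beta_growth by blast
  obtain X :: nat where X: "real (nr + 1) / \<epsilon> \<le> real X" using real_arch_simple by blast
  obtain id where id: "\<And>i. i \<ge> id \<Longrightarrow> X + k0 + 1 \<le> beta i" using beta_unbounded by blast
  define iL where "iL = i1 + ia + ib + ic + id + 10"
  obtain n0 where n0: "n0 \<ge> Suc (beta iL)" "n0 \<le> t * card ({1..n0} - S)" using missing by blast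
  define M where "M = {1..n0} - S"
  define i0 where "i0 = (LEAST i. n0 \<le> beta i)"
  have "\<exists>i. n0 \<le> beta i" using beta_unbounded by blast
  then have i0: "n0 \<le> beta i0" unfolding i0_def by (rule LeastI_ex)
  have i0': "beta i < n0" if "i < i0" for i using not_less_Least[of i "\<lambda>i. n0 \<le> beta i"] that unfolding i0_def by auto
  have "iL < i0" using n0(1) i0 beta_mono[of i0 iL] by (metis Suc_le_lessD le_trans not_less not_less_eq_eq)
  \<comment> \<open>The offset 5 is enough to ensure \<open>a n0 \<le> 2 ^ (i - 2)\<close> for every
    later block \<open>i\<close>.\<close>
  define js where "js = i0 + 5"
  have "\<exists>l. js \<le> l \<and> l < 2 ^ s * js \<and> \<epsilon> / 2 * real (beta (Suc l) - beta l) \<le> real (card (S \<inter> {beta l<..beta (Suc l)}))"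
  proof (rule exists_dense_block[OF large])
    show "js \<le> 2 ^ s * js" by simp
    show "k0 \<le> beta (2 ^ s * js)" using id[of "2 ^ s * js"] \<open>iL < i0\<close> \<open>js \<le> 2 ^ s * js\<close> unfolding iL_def js_def by linarith
    show "0 < beta js" using id[of js] \<open>iL < i0\<close> unfolding iL_def js_def by linarith
    show "real (beta js) \<le> \<epsilon> / 2 * real (beta (2 ^ s * js))" using ia[of js] \<open>iL < i0\<close> unfolding iL_def js_def by linarith
  qed
  then obtain i where i: "js \<le> i" "i < 2 ^ s * js"
    and dense: "\<epsilon> / 2 * real (beta (Suc i) - beta i) \<le> real (card (S \<inter> {beta i<..beta (Suc i)}))" by blast
  have big: "i1 \<le> i" "ib \<le> i" "ic \<le> i" "id \<le> i" "i0 + 5 \<le> i" "10 \<le> i0" "1 \<le> i" "ib \<le> i0 - 2" "ic \<le> i0"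
    using i \<open>iL < i0\<close> unfolding iL_def js_def by auto
  define V where "V = S \<inter> {beta i<..beta (Suc i)}"
  obtain E where E: "E \<subseteq> V" "card E = card V div 2" "\<And>x y. x \<in> E \<Longrightarrow> y \<in> V - E \<Longrightarrow> x < y"
    using lower_part[of V "card V div 2"] unfolding V_def by auto
  define U where "U = V - E"
  have finV: "finite V" unfolding V_def by simp
  then have finE: "finite E" using E finite_subset by blast
  have "card U = card V - card V div 2" unfolding U_def using E finE by (simp add: card_Diff_subset)
  then have "real (card V) \<le> 2 * real (card U)" by linarith
  then have cardU: "\<epsilon> / 4 * real (beta (Suc i) - beta i) \<le> real (card U)" using dense unfolding V_def by linarith
  have cardE: "Z + 2 * K * i \<le> card E"
  proof -
    have "real (Z + 2 * K + 1) \<le> \<epsilon> / 4 * real H1" using H1 eps by (simp add: field_simps)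
    also have "\<dots> \<le> \<epsilon> / 4 * real H" unfolding H_def using eps by simp
    finally have "real (Z + 2 * K + 1) * real i \<le> \<epsilon> / 4 * real H * real i" by (rule mult_right_mono) simp
    also have "\<dots> = \<epsilon> / 4 * real (H * i)" by simp
    also have "\<dots> \<le> \<epsilon> / 4 * real (beta (Suc i) - beta i)" using ib[of i] big eps by (intro mult_left_mono) (auto simp: of_nat_le_iff simp del: of_nat_mult)
    also have "\<dots> \<le> real (card V) / 2" using dense unfolding V_def by simp
    finally have "real ((Z + 2 * K + 1) * i) \<le> real (card V) / 2" by (simp only: of_nat_mult)
    then have "(Z + 2 * K + 1) * i \<le> card E"
      unfolding E(2) by (metis of_nat_le_iff of_nat_numeral less_eq_div_iff_mult_less_eq pos_le_divide_eq zero_less_numeral of_nat_mult)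
    moreover have "Z \<le> Z * i" using big by simp
    moreover have "(Z + 2 * K + 1) * i = Z * i + 2 * K * i + i" by (simp add: algebra_simps)
    ultimately show ?thesis by linarith
  qed
  have cardM: "2 * Z + 4 * K * i \<le> card M"
  proof -
    \<comment> \<open>By minimality of \<open>i0\<close>, \<open>n0\<close> exceeds
      \<open>beta (i0 - 1)\<close> and so \<open>H * (i0 - 2)\<close>; a fraction
      \<open>1 / t\<close> of the indices up to \<open>n0\<close> is missing.\<close>
    have "H * (i0 - 2) \<le> beta (Suc (i0 - 2))" using ib[of "i0 - 2"] big by linarith
    also have "\<dots> < n0" using i0'[of "Suc (i0 - 2)"] big by simp
    finally have "H * (i0 - 2) \<le> t * card M" using n0(2) unfolding M_def by linarith
    moreover have "t * (2 * Z + 4 * K) * 2 ^ s * js \<le> H * (i0 - 2)"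
    proof -
      have "js \<le> 3 * (i0 - 2)" unfolding js_def using big by linarith
      then have "t * (2 * Z + 4 * K) * 2 ^ s * js \<le> t * (2 * Z + 4 * K) * 2 ^ s * (3 * (i0 - 2))" by (rule mult_le_mono2)
      also have "\<dots> \<le> H * (i0 - 2)" unfolding H_def by (simp add: algebra_simps)
      finally show ?thesis .
    qed
    ultimately have "t * (2 * Z + 4 * K) * 2 ^ s * js \<le> t * card M" by (rule order_trans[rotated])
    then have "t * ((2 * Z + 4 * K) * (2 ^ s * js)) \<le> t * card M" by (simp only: mult.assoc)
    moreover have "t > 0" using n0 by (cases t) auto
    ultimately have "(2 * Z + 4 * K) * (2 ^ s * js) \<le> card M" by (simp only: nat_mult_le_cancel1)
    moreover have "(2 * Z + 4 * K) * i \<le> (2 * Z + 4 * K) * (2 ^ s * js)" using i by (intro mult_le_mono2) simp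
    moreover have "Z \<le> Z * i" using big by simp
    moreover have "(2 * Z + 4 * K) * i = 2 * (Z * i) + 4 * K * i" by (simp add: algebra_simps)
    ultimately show ?thesis by linarith
  qed
  have amono: "\<And>i j. 1 \<le> i \<Longrightarrow> i \<le> j \<Longrightarrow> a i \<le> a j" using interlace_mono[OF inter] by blast
  have main: "a n + K * i * 2 ^ i \<le> sum a (S \<inter> {..<n})" if n: "n \<in> S" "u \<in> U" "u \<le> n" for n u
  proof -
    define P where "P = S \<inter> {..<n}"
    define m where "m = card P"
    have P: "finite P" "P \<subseteq> {1..}" "card P = m" using S unfolding P_def m_def by auto
    have "beta i < u" using n unfolding U_def V_def by auto
    then have nb: "beta i < n" using n by simp
    have "X + k0 + 1 \<le> beta i" using id big by simp
    then have n1: "X \<le> n - 1" "k0 \<le> n - 1" "1 \<le> n" using nb by auto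
    have "P = S \<inter> {1..n - 1}" using S n1 unfolding P_def by auto
    then have dens: "\<epsilon> * (real n - 1) \<le> real m" using large[OF n1(2)] n1(3) unfolding m_def by (simp add: of_nat_diff)
    have "real X \<le> real n - 1" using n1 by linarith
    then have "real (nr + 1) / \<epsilon> \<le> real n - 1" using X by linarith
    then have "real (nr + 1) \<le> \<epsilon> * (real n - 1)" using eps by (simp add: field_simps)
    then have "nr + 1 \<le> m" using dens by linarith
    then have m: "nr \<le> m" "1 \<le> m" by auto
    have up: "a n \<le> sum a {1..m} + Z * a m"
      unfolding Z_def by (rule term_le_partial_sum[OF inter nr(2) nr(1) m(1) n1(3) dens])
    define p :: nat where "p = 2 ^ (i - 1)"
    have p: "2 ^ i = 2 * p" unfolding p_def using big(7) by (simp flip: power_Suc)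
    \<comment> \<open>If \<open>a m\<close> is small compared with the block, the surplus comes from the terms in \<open>E\<close>, otherwise from the
      indices in \<open>M\<close>, which \<open>S\<close> misses long before \<open>m\<close>.\<close>
    show ?thesis
    proof (cases "a m \<le> p")
      case True
      have E2: "2 * p < a x" if "x \<in> E" for x
      proof -
        have x: "beta i < x" using that E(1) unfolding V_def by auto
        then have "\<not> b x \<le> 2 ^ i" using b_le_iff[of x i] by auto
        then show ?thesis using inter[of x] x p by auto
      qed
      have "sum a {1..m} + card E * (2 * p) \<le> sum a P + card E * a m"
      proof (rule sum_present_large[OF amono m(2) P])
        have "x \<in> P - {1..m}" if "x \<in> E" for x
        proof -
          have "x \<in> S" using that E(1) unfolding V_def by auto
          moreover have "x < u" using that n(2) E(3) unfolding U_def by blast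
          moreover have "\<not> x \<le> m" using E2[OF that] True amono[of x m] S \<open>x \<in> S\<close> by fastforce
          ultimately show ?thesis using n(3) unfolding P_def by auto
        qed
        then show "E \<subseteq> P - {1..m}" by blast
        show "2 * p \<le> a j" if "j \<in> E" for j using E2[OF that] by simp
      qed auto
      moreover have "card E * a m \<le> card E * p" using True by simp
      moreover have "card E * (2 * p) = 2 * (card E * p)" by simp
      ultimately have "sum a {1..m} + card E * p \<le> sum a P" by linarith
      moreover have "(Z + 2 * K * i) * p \<le> card E * p" using cardE by (rule mult_le_mono1)
      then have "Z * p + K * i * 2 ^ i \<le> card E * p" unfolding p by (simp add: algebra_simps)
      moreover have "Z * a m \<le> Z * p" using True by simp
      ultimately show ?thesis using up unfolding P_def by linarith
    next
      case False
      have n01: "1 \<le> n0" using n0 by simp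
      have "n0 < beta (Suc i0)" using i0 ic[of i0] big by linarith
      then have "b (Suc n0) \<le> 2 ^ Suc i0" by (subst b_le_iff) auto
      then have "a n0 \<le> 2 ^ Suc i0" using inter[OF n01] by linarith
      also have "(2::nat) ^ Suc i0 \<le> 2 ^ (i - 2)" using big by (intro power_increasing) auto
      finally have "a n0 \<le> 2 ^ (i - 2)" .
      moreover have "i - 1 = Suc (i - 2)" using big by simp
      then have "p = 2 * 2 ^ (i - 2)" unfolding p_def by simp
      ultimately have an0: "2 * a n0 \<le> p" by simp
      have "n0 \<le> m" using an0 False amono[of m n0] m(2) by fastforce
      have "sum a {1..m} + card M * a m \<le> sum a P + card M * a n0"
      proof (rule sum_missing_small[OF amono m(2) P])
        show "M \<subseteq> {1..m} - P" using \<open>n0 \<le> m\<close> unfolding M_def P_def by auto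
        show "a j \<le> a n0" if "j \<in> M" for j using that amono[of j n0] unfolding M_def by auto
      qed auto
      moreover have "2 * (card M * a n0) = card M * (2 * a n0)" by simp
      moreover have "card M * (2 * a n0) \<le> card M * a m" using an0 False by (intro mult_le_mono2) simp
      ultimately have "2 * sum a {1..m} + card M * a m \<le> 2 * sum a P" by linarith
      moreover have "(2 * Z + 4 * K * i) * a m \<le> card M * a m" using cardM by (rule mult_le_mono1)
      then have "2 * (Z * a m) + 4 * (K * i * a m) \<le> card M * a m" by (simp add: algebra_simps)
      moreover have "K * i * p \<le> K * i * a m" using False by (intro mult_le_mono2) simp
      moreover have "K * i * 2 ^ i = 2 * (K * i * p)" unfolding p by simp
      ultimately show ?thesis using up unfolding P_def by linarith
    qed
  qed
  show ?thesis
    by (intro exI[of _ i] conjI exI[of _ U]) (use big cardU main in \<open>auto simp: U_def V_def\<close>)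
qed

section \<open>Construction of the interlacing sequence\<close>

lemma exists_interlacing:
  assumes gap: "filterlim (Dlt b) at_top sequentially"
  shows "\<exists>a D i0. (\<forall>n\<ge>1. b n \<le> a n \<and> a n < b (Suc n)) \<and> D > 0 \<and> (\<forall>n>beta i0. [a n = 1] (mod D)) \<and>
    (\<forall>g. \<exists>K i2. \<forall>i\<ge>i2. \<forall>U\<subseteq>{beta i<..beta (Suc i)}.
      \<epsilon> / 4 * real (beta (Suc i) - beta i) \<le> real (card U) \<longrightarrow>
      (\<exists>F\<subseteq>U. sum a F \<le> K * i * 2 ^ i \<and> (\<exists>z. \<forall>l\<le>g. z + l * D\<^sup>2 \<in> subset_sums a F)))"
proof -
  \<comment> \<open>\<open>U\<close> has density at least \<open>\<epsilon> / 4\<close> in its block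
    and loses at most \<open>\<epsilon> / 8\<close> to the subtracted terms; the rest is at least a
    fraction \<open>1 / L\<close>.\<close>
  obtain L :: nat where L: "8 / \<epsilon> \<le> real L" using real_arch_simple by blast
  define k :: nat where "k = 9 ^ L"
  define D :: nat where "D = fact k"
  have "D > 0" unfolding D_def by simp
  have "\<forall>\<^sub>F n in sequentially. real (D * k + 2) \<le> Dlt b n" using gap unfolding filterlim_at_top by blast
  then obtain ng where ng: "\<And>n. n \<ge> ng \<Longrightarrow> real (D * k + 2) \<le> Dlt b n" unfolding eventually_sequentially by blast
  obtain ia where ia: "\<And>i. i \<ge> ia \<Longrightarrow> beta i + 1 * i \<le> beta (Suc i)" using beta_growth by blast
  obtain ib where ib: "\<And>i. i \<ge> ib \<Longrightarrow> ng \<le> beta i" using beta_unbounded by blast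
  define i0 where "i0 = ia + ib + k + 2"
  define I where "I i = {beta i<..beta (Suc i)}" for i
  \<comment> \<open>The least multiplier with \<open>b n < D * q n\<close>; a gap of
    \<open>D * k + 2\<close> leaves room for \<open>k\<close> consecutive multipliers before
    \<open>b (Suc n)\<close>.\<close>
  define q where "q n = b n div D + 1" for n
  have "\<exists>c. (\<forall>n\<in>I i. q n \<le> c n \<and> c n < q n + k) \<and>
    (\<forall>a U g. (\<forall>n\<in>I i. a n = 1 + D * c n) \<longrightarrow> U \<subseteq> I i \<longrightarrow>
      card (I i) \<le> L * (card U - k * (g * D) * (2 * (8 * i)) - (2 * (8 * i) + 1)) \<longrightarrow>
      (\<exists>F\<subseteq>U. card F \<le> k * (g * D) * (2 * (8 * i)) \<and> (\<exists>z. \<forall>l\<le>g. z + l * D\<^sup>2 \<in> subset_sums a F)))"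
    if i: "i0 \<le> i" for i
    unfolding D_def k_def
  proof (rule exists_block_choice)
    show "finite (I i)" unfolding I_def by simp
    show "I i \<noteq> {}" using ia[of i] i unfolding I_def i0_def by auto
    show "2 ^ (8 * i) * (8 * i * 2 ^ (i + 2) + 1) < (3::nat) ^ (8 * i)"
      by (rule growth_inequality) (use i in \<open>simp add: i0_def\<close>)
    fix n assume n: "n \<in> I i"
    have "k + 1 \<le> Suc i" using i unfolding i0_def by simp
    also have "\<dots> \<le> 2 ^ Suc i" using less_exp[of "Suc i"] by (rule less_imp_le)
    finally have "k + 1 \<le> 2 ^ Suc i" .
    moreover have "b n \<le> 2 ^ Suc i" using n b_le_iff[of n "Suc i"] unfolding I_def by auto
    moreover have "b n div D \<le> b n" by simp
    moreover have "(2::nat) ^ (i + 2) = 2 ^ Suc i + 2 ^ Suc i" by simp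
    ultimately show "q n + 9 ^ L \<le> 2 ^ (i + 2)" unfolding q_def k_def[symmetric] by linarith
  qed
  then obtain cf where cf: "\<And>i n. i0 \<le> i \<Longrightarrow> n \<in> I i \<Longrightarrow> q n \<le> cf i n \<and> cf i n < q n + k"
    and prog: "\<And>i a U g. i0 \<le> i \<Longrightarrow> \<forall>n\<in>I i. a n = 1 + D * cf i n \<Longrightarrow> U \<subseteq> I i \<Longrightarrow>
      card (I i) \<le> L * (card U - k * (g * D) * (2 * (8 * i)) - (2 * (8 * i) + 1)) \<Longrightarrow>
      \<exists>F\<subseteq>U. card F \<le> k * (g * D) * (2 * (8 * i)) \<and> (\<exists>z. \<forall>l\<le>g. z + l * D\<^sup>2 \<in> subset_sums a F)"
    by metis
  \<comment> \<open>The blocks are disjoint, so the choices made in them combine to one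
    sequence.\<close>
  define blk where "blk n = (LEAST i. n \<le> beta (Suc i))" for n
  define a where "a n = (if beta i0 < n then 1 + D * cf (blk n) n else b n)" for n
  have blk: "blk n = i" if "n \<in> I i" for n i
    unfolding blk_def
  proof (rule Least_equality)
    show "n \<le> beta (Suc i)" using that unfolding I_def by simp
    fix j assume j: "n \<le> beta (Suc j)"
    show "i \<le> j"
    proof (rule ccontr)
      assume "\<not> i \<le> j"
      then have "beta (Suc j) \<le> beta i" by (intro beta_mono) simp
      then show False using j that unfolding I_def by simp
    qed
  qed
  have inI: "i0 \<le> blk n \<and> n \<in> I (blk n)" if "beta i0 < n" for n
  proof -
    obtain j where "n \<le> beta j" using beta_unbounded by blast
    then have "n \<le> beta (Suc j)" using beta_mono[of j "Suc j"] by simp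
    then have 1: "n \<le> beta (Suc (blk n))" unfolding blk_def by (rule LeastI)
    have 2: "i0 \<le> blk n"
    proof (rule ccontr)
      assume "\<not> i0 \<le> blk n"
      then have "beta (Suc (blk n)) \<le> beta i0" by (intro beta_mono) simp
      then show False using 1 that by simp
    qed
    moreover have "beta (blk n) < n"
    proof (cases "blk n = i0")
      case False
      then obtain m where m: "blk n = Suc m" using 2 by (cases "blk n") auto
      then have "\<not> n \<le> beta (Suc m)" using not_less_Least[of m "\<lambda>i. n \<le> beta (Suc i)"] unfolding blk_def by auto
      then show ?thesis using m by simp
    qed (use that in simp)
    ultimately show ?thesis using 1 unfolding I_def by simp
  qed
  have aI: "a n = 1 + D * cf i n" if "n \<in> I i" "i0 \<le> i" for n i
  proof -
    have "beta i0 < n" using that beta_mono[of i0 i] unfolding I_def by auto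
    then show ?thesis using blk[OF that(1)] unfolding a_def by simp
  qed
  have inter: "b n \<le> a n \<and> a n < b (Suc n)" if "n \<ge> 1" for n
  proof (cases "beta i0 < n")
    case True
    then have c: "q n \<le> cf (blk n) n" "cf (blk n) n < q n + k" using cf inI by auto
    have "ng \<le> n" using ib[of i0] True unfolding i0_def by simp
    then have gp: "b n + (D * k + 2) \<le> b (Suc n)" using ng[of n] unfolding Dlt_def by linarith
    have dm: "b n = D * (b n div D) + b n mod D" "b n mod D < D" using \<open>D > 0\<close> by auto
    have "D * q n \<le> D * cf (blk n) n" using c by simp
    moreover have "D * q n = D * (b n div D) + D" unfolding q_def by simp
    ultimately have "b n \<le> D * cf (blk n) n" using dm by linarith
    moreover have "D * cf (blk n) n \<le> D * (b n div D + k)" using c unfolding q_def by (intro mult_le_mono2) simp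
    then have "D * cf (blk n) n \<le> b n + D * k" using dm(1) unfolding distrib_left by linarith
    ultimately show ?thesis using gp True unfolding a_def by simp
  next
    case False
    then show ?thesis using step that unfolding a_def by simp
  qed
  have res: "[a n = 1] (mod D)" if "beta i0 < n" for n
    using that unfolding a_def cong_def by (simp only: if_True mod_mult_self2)
  \<comment> \<open>\<open>K\<close> and \<open>i2\<close> may depend on \<open>g\<close>, but
    \<open>a\<close> and \<open>D\<close> may not: the length \<open>g\<close> needed becomes known
    only with the index set \<open>S\<close>.\<close>
  have "\<exists>K i2. \<forall>i\<ge>i2. \<forall>U\<subseteq>I i. \<epsilon> / 4 * real (beta (Suc i) - beta i) \<le> real (card U) \<longrightarrow>
      (\<exists>F\<subseteq>U. sum a F \<le> K * i * 2 ^ i \<and> (\<exists>z. \<forall>l\<le>g. z + l * D\<^sup>2 \<in> subset_sums a F))" for g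
  proof -
    define R where "R = k * (g * D)"
    obtain H :: nat where H: "8 / \<epsilon> * real (16 * R + 17) \<le> real H" using real_arch_simple by blast
    obtain ic where ic: "\<And>i. i \<ge> ic \<Longrightarrow> beta i + H * i \<le> beta (Suc i)" using beta_growth by blast
    \<comment> \<open>The constant \<open>64 * R\<close> comes from at most
      \<open>16 * R * i\<close> terms, each at most \<open>2 ^ (i + 2)\<close>.\<close>
    have "\<exists>F\<subseteq>U. sum a F \<le> (64 * R) * i * 2 ^ i \<and> (\<exists>z. \<forall>l\<le>g. z + l * D\<^sup>2 \<in> subset_sums a F)"
      if i: "i \<ge> i0 + ic" and U: "U \<subseteq> I i" "\<epsilon> / 4 * real (beta (Suc i) - beta i) \<le> real (card U)" for i U
    proof -
      have ige: "i0 \<le> i" "ic \<le> i" "1 \<le> i" "ia \<le> i" using i unfolding i0_def by auto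
      define N where "N = beta (Suc i) - beta i"
      have "card (I i) = N" unfolding I_def N_def by simp
      define Y where "Y = R * (2 * (8 * i)) + (2 * (8 * i) + 1)"
      have "Y \<le> (16 * R + 17) * i" unfolding Y_def using ige by (simp add: algebra_simps)
      then have "real Y \<le> real ((16 * R + 17) * i)" by (simp only: of_nat_le_iff)
      also have "\<dots> = real (16 * R + 17) * real i" by (rule of_nat_mult)
      also have "\<dots> \<le> \<epsilon> / 8 * real H * real i" using H eps by (intro mult_right_mono) (auto simp: field_simps)
      also have "\<dots> = \<epsilon> / 8 * real (H * i)" by simp
      also have "\<dots> \<le> \<epsilon> / 8 * real N"
      proof -
        have "H * i \<le> N" using ic[OF ige(2)] unfolding N_def by simp
        then show ?thesis using eps by (simp only: of_nat_le_iff mult_left_mono[of "real (H * i)" "real N" "\<epsilon> / 8"])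
      qed
      finally have Y: "real Y \<le> \<epsilon> / 8 * real N" .
      have "\<epsilon> / 4 * real N = 2 * (\<epsilon> / 8 * real N)" by simp
      then have "real Y + \<epsilon> / 8 * real N \<le> real (card U)" using Y U(2) unfolding N_def by linarith
      moreover have "0 \<le> \<epsilon> / 8 * real N" using eps by simp
      ultimately have YU: "\<epsilon> / 8 * real N \<le> real (card U - Y)" by linarith
      have "real N = 8 / \<epsilon> * (\<epsilon> / 8 * real N)" using eps by simp
      also have "\<dots> \<le> real L * real (card U - Y)"
        using L YU eps by (intro mult_mono) auto
      finally have "real N \<le> real (L * (card U - Y))" by simp
      then have "N \<le> L * (card U - Y)" by (simp only: of_nat_le_iff)
      then have "card (I i) \<le> L * (card U - R * (2 * (8 * i)) - (2 * (8 * i) + 1))"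
        unfolding \<open>card (I i) = N\<close> Y_def by (simp only: diff_diff_left)
      then obtain F z where F: "F \<subseteq> U" "card F \<le> R * (2 * (8 * i))" "\<forall>l\<le>g. z + l * D\<^sup>2 \<in> subset_sums a F"
        using prog[OF ige(1) _ U(1), of a g] aI ige(1) unfolding R_def by metis
      have "sum a F \<le> of_nat (card F) * 2 ^ (i + 2)"
      proof (rule sum_bounded_above)
        fix n assume "n \<in> F"
        then have n: "beta i < n" "n \<le> beta (Suc i)" using F(1) U(1) unfolding I_def by auto
        then have "Suc n \<le> beta (i + 2)" using ia[of "Suc i"] ige by simp
        then have "b (Suc n) \<le> 2 ^ (i + 2)" using b_le_iff[of "Suc n" "i + 2"] by simp
        then show "a n \<le> 2 ^ (i + 2)" using inter[of n] n by simp
      qed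
      also have "\<dots> \<le> R * (2 * (8 * i)) * 2 ^ (i + 2)" using F(2) by (simp only: of_nat_id mult_le_mono1)
      also have "\<dots> = (64 * R) * i * 2 ^ i" by (simp add: power_add)
      finally show ?thesis using F by blast
    qed
    then show ?thesis by blast
  qed
  then show ?thesis unfolding I_def using inter \<open>D > 0\<close> res by blast
qed

section \<open>Completeness of dense subsequences\<close>

lemma interlacing_eps_complete:
  assumes inter: "\<And>n. 1 \<le> n \<Longrightarrow> b n \<le> a n \<and> a n < b (Suc n)" and "D > 0"
    and res: "\<And>n. beta i0 < n \<Longrightarrow> [a n = 1] (mod D)"
    and prog: "\<And>g. \<exists>K i2. \<forall>i\<ge>i2. \<forall>U\<subseteq>{beta i<..beta (Suc i)}.
      \<epsilon> / 4 * real (beta (Suc i) - beta i) \<le> real (card U) \<longrightarrow>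
      (\<exists>F\<subseteq>U. sum a F \<le> K * i * 2 ^ i \<and> (\<exists>z. \<forall>l\<le>g. z + l * D\<^sup>2 \<in> subset_sums a F))"
  shows "eps_complete \<epsilon> a"
  unfolding eps_complete_def
proof (intro allI impI)
  fix S :: "nat set"
  assume S: "S \<subseteq> {1..}"
    and "\<forall>\<^sub>F n in sequentially. \<epsilon> * real (card {i. 1 \<le> i \<and> a i \<le> n}) \<le> real (card {i \<in> S. a i \<le> n})"
  then obtain N where N: "\<And>n. n \<ge> N \<Longrightarrow> \<epsilon> * real (card {i. 1 \<le> i \<and> a i \<le> n}) \<le> real (card {i \<in> S. a i \<le> n})"
    unfolding eventually_sequentially by blast
  have less: "a i < a j" if "1 \<le> i" "i < j" for i j
  proof -
    have "b (Suc i) \<le> b j" using that by (intro b_mono) auto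
    then show ?thesis using inter[of i] inter[of j] that by simp
  qed
  have le_iff: "a i \<le> a j \<longleftrightarrow> i \<le> j" if "1 \<le> i" "1 \<le> j" for i j
    using less[of i j] less[of j i] that by (metis less_imp_le linorder_neqE_nat not_le)
  \<comment> \<open>Taking the density at the value \<open>n = a k\<close> turns it into a density
    of indices.\<close>
  have dens: "\<epsilon> * real k \<le> real (card (S \<inter> {1..k}))" if "k \<ge> N + 1" for k
  proof -
    have "N \<le> a k" using b_ge[of k] inter[of k] that by simp
    moreover have "{i. 1 \<le> i \<and> a i \<le> a k} = {1..k}" using le_iff that by auto
    moreover have "a i \<le> a k \<longleftrightarrow> i \<in> {1..k}" if "i \<in> S" for i
      using le_iff[of i k] S that \<open>k \<ge> N + 1\<close> by auto
    then have "{i \<in> S. a i \<le> a k} = S \<inter> {1..k}" by blast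
    ultimately show ?thesis using N[of "a k"] by simp
  qed
  have "\<exists>T\<subseteq>S. \<exists>k1 t. (\<forall>k\<ge>k1. \<epsilon> * real k \<le> real (card (T \<inter> {1..k}))) \<and>
      (\<forall>n. \<exists>m\<ge>n. m \<le> t * card ({1..m} - T))"
    by (rule thin_subset[OF eps(2)]) (fact dens)
  then obtain T k1 t where T: "T \<subseteq> S"
    and large: "\<forall>k\<ge>k1. \<epsilon> * real k \<le> real (card (T \<inter> {1..k}))"
    and missing: "\<forall>n. \<exists>m\<ge>n. m \<le> t * card ({1..m} - T)" by blast
  note large = large[rule_format] and missing = missing[rule_format]
  have T1: "T \<subseteq> {1..}" using T S by blast
  have apos: "0 < a n" if "n \<in> T" for n using that T1 inter[of n] pos[of n] by force
  have infT: "infinite T"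
  proof
    assume fin: "finite T"
    obtain k where k: "(real (card T) + 1) / \<epsilon> < real k" using reals_Archimedean2 by blast
    have "\<epsilon> * real (k + k1) \<le> real (card (T \<inter> {1..k + k1}))" by (rule large) simp
    also have "\<dots> \<le> real (card T)" using fin by (simp add: card_mono)
    finally have "\<epsilon> * real (k + k1) \<le> real (card T)" .
    moreover have "\<epsilon> * real k \<le> \<epsilon> * real (k + k1)" using eps by (intro mult_left_mono) auto
    ultimately have "\<epsilon> * real k \<le> real (card T)" by linarith
    then show False using k eps by (simp add: field_simps)
  qed
  have slack: "\<exists>i\<ge>i1. \<exists>U\<subseteq>T \<inter> {beta i<..beta (Suc i)}. \<epsilon> / 4 * real (beta (Suc i) - beta i) \<le> real (card U) \<and>
    (\<forall>n\<in>T. (\<exists>u\<in>U. u \<le> n) \<longrightarrow> a n + K * i * 2 ^ i \<le> sum a (T \<inter> {..<n}))" for i1 K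
    by (rule exists_slack_block) (fact inter T1 large missing)+
  obtain ia where ia: "\<And>i. i \<ge> ia \<Longrightarrow> beta i + 1 * i \<le> beta (Suc i)" "ia \<ge> 1" using beta_growth by blast
  \<comment> \<open>With \<open>K = 0\<close> only the greedy inequality from \<open>u\<close> on is
    obtained; for smaller indices \<open>a n \<le> a u\<close> suffices.\<close>
  obtain i U where i: "ia \<le> i" "U \<subseteq> T \<inter> {beta i<..beta (Suc i)}" "\<epsilon> / 4 * real (beta (Suc i) - beta i) \<le> real (card U)"
    and iU: "\<forall>n\<in>T. (\<exists>u\<in>U. u \<le> n) \<longrightarrow> a n + 0 * i * 2 ^ i \<le> sum a (T \<inter> {..<n})"
    using slack[of ia 0] by blast
  have "0 < real (beta (Suc i) - beta i)" using ia(1)[OF i(1)] ia(2) i(1) by simp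
  then have "0 < \<epsilon> / 4 * real (beta (Suc i) - beta i)" using eps by (intro mult_pos_pos) auto
  then have "0 < real (card U)" using i(3) by linarith
  then have "U \<noteq> {}" by auto
  then obtain u where u: "u \<in> U" by blast
  have greedy: "a n \<le> a u + sum a (T \<inter> {..<n})" if "n \<in> T" for n
  proof (cases "u \<le> n")
    case True
    then have "a n + 0 * i * 2 ^ i \<le> sum a (T \<inter> {..<n})" using iU that u by blast
    then show ?thesis by simp
  next
    case False
    moreover have "1 \<le> n" "1 \<le> u" using that u i(2) T1 by auto
    ultimately show ?thesis using le_iff[of n u] by simp
  qed
  have "infinite (T - {..beta i0})" using infT by simp
  moreover have "\<And>n. n \<in> T - {..beta i0} \<Longrightarrow> [a n = 1] (mod D)" using res by auto
  ultimately obtain T2 where T2: "T2 \<subseteq> T - {..beta i0}" "finite T2" "\<And>r. \<exists>J\<subseteq>T2. [sum a J = r] (mod D\<^sup>2)"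
    using exists_residue_cover[of "T - {..beta i0}" a D] \<open>D > 0\<close> by blast
  \<comment> \<open>\<open>a u\<close> is the greedy constant and \<open>sum a T2\<close> makes up
    for deleting \<open>T2\<close>. The sum of \<open>F\<close> must not enter, because
    \<open>F\<close> is chosen with a length that depends on \<open>g\<close>.\<close>
  define g where "g = a u + sum a T2"
  obtain K i2 where K: "\<forall>i\<ge>i2. \<forall>U\<subseteq>{beta i<..beta (Suc i)}.
      \<epsilon> / 4 * real (beta (Suc i) - beta i) \<le> real (card U) \<longrightarrow>
      (\<exists>F\<subseteq>U. sum a F \<le> K * i * 2 ^ i \<and> (\<exists>z. \<forall>l\<le>g + sum a T2. z + l * D\<^sup>2 \<in> subset_sums a F))"
    using prog[of "g + sum a T2"] by blast
  obtain X where X: "T2 \<subseteq> {..<X}" using finite_nat_bounded[OF T2(2)] by blast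
  obtain i3 where i3: "\<And>i. i \<ge> i3 \<Longrightarrow> X \<le> beta i" using beta_unbounded by blast
  \<comment> \<open>This second block comes after \<open>K\<close>, so its surplus matches the sum
    of \<open>F\<close>, and it lies beyond all of \<open>T2\<close>.\<close>
  obtain j V where j: "i2 + i3 \<le> j" "V \<subseteq> T \<inter> {beta j<..beta (Suc j)}" "\<epsilon> / 4 * real (beta (Suc j) - beta j) \<le> real (card V)"
    and jV: "\<forall>n\<in>T. (\<exists>u\<in>V. u \<le> n) \<longrightarrow> a n + K * j * 2 ^ j \<le> sum a (T \<inter> {..<n})"
    using slack[of "i2 + i3" K] by blast
  have "i2 \<le> j" and Vj: "V \<subseteq> {beta j<..beta (Suc j)}" using j(1,2) by auto
  from K[rule_format, OF this j(3)] obtain F z where F: "F \<subseteq> V" "sum a F \<le> K * j * 2 ^ j"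
    "\<forall>l\<le>g + sum a T2. z + l * D\<^sup>2 \<in> subset_sums a F" by blast
  from Vj have finF: "finite F" using F(1) by (meson finite_greaterThanAtMost finite_subset)
  show "complete_sub a S"
  proof (rule complete_sub_from_parts)
    let ?T1 = "T - T2 - F"
    show "?T1 \<subseteq> S" "T2 \<subseteq> S" "F \<subseteq> S" using T T2(1) F(1) j(2) by auto
    show "?T1 \<inter> T2 = {}" "?T1 \<inter> F = {}" by auto
    show "T2 \<inter> F = {}"
    proof -
      have "X \<le> beta j" using i3 j(1) by simp
      then show ?thesis using X F(1) j(2) by fastforce
    qed
    show "infinite ?T1" using infT T2(2) finF by simp
    show "0 < a n" if "n \<in> ?T1" for n using apos that by blast
    show "a n \<le> g + sum a (?T1 \<inter> {..<n})" if n: "n \<in> ?T1" for n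
    proof -
      have split: "sum a (T \<inter> {..<n}) \<le> sum a (?T1 \<inter> {..<n}) + (sum a T2 + sum a (F \<inter> {..<n}))"
      proof -
        have "sum a (T \<inter> {..<n}) \<le> sum a ((?T1 \<inter> {..<n}) \<union> (T2 \<union> (F \<inter> {..<n})))"
          using T2(2) by (intro sum_mono2) auto
        also have "\<dots> \<le> sum a (?T1 \<inter> {..<n}) + sum a (T2 \<union> (F \<inter> {..<n}))"
          using T2(2) by (simp add: sum.union_inter_neutral sum_Un_nat)
        also have "\<dots> \<le> sum a (?T1 \<inter> {..<n}) + (sum a T2 + sum a (F \<inter> {..<n}))"
          using T2(2) by (simp add: sum_Un_nat)
        finally show ?thesis .
      qed
      \<comment> \<open>Before the first element of \<open>V\<close> the deletion of
        \<open>F\<close> changes nothing; from there on the surplus covers it.\<close>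
      show ?thesis
      proof (cases "\<exists>v\<in>V. v \<le> n")
        case True
        have "sum a (F \<inter> {..<n}) \<le> sum a F" using finF by (intro sum_mono2) auto
        moreover have "a n + K * j * 2 ^ j \<le> sum a (T \<inter> {..<n})" using jV True n by blast
        ultimately show ?thesis using split F(2) unfolding g_def by linarith
      next
        case False
        then have "F \<inter> {..<n} = {}" using F(1) by fastforce
        then show ?thesis using greedy[of n] n split unfolding g_def by simp
      qed
    qed
    show "finite T2" by (rule T2)
    show "\<exists>J\<subseteq>T2. [sum a J = r] (mod D\<^sup>2)" for r by (rule T2)
    show "z + l * D\<^sup>2 \<in> subset_sums a F" if "l \<le> g + sum a T2" for l using F(3) that by blast
    show "D\<^sup>2 > 0" using \<open>D > 0\<close> by simp
  qed
qed

end

theorem theorem4p3: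
  fixes \<epsilon> :: real and b :: "nat \<Rightarrow> nat"
  assumes "0 < \<epsilon>" and "\<epsilon> < 1"
    and "eps_friendly \<epsilon> b"
  shows "\<exists>a :: nat \<Rightarrow> nat. (\<forall>n\<ge>1. 0 < a n \<and> b n \<le> a n \<and> a n < b (Suc n)) \<and> eps_complete \<epsilon> a"
proof -
  obtain C where "friendly_seq \<epsilon> b C"
    using assms unfolding eps_friendly_def friendly_seq_def by blast
  then interpret friendly_seq \<epsilon> b C .
  have "filterlim (Dlt b) at_top sequentially" using assms(3) unfolding eps_friendly_def by blast
  from exists_interlacing[OF this] obtain a D i0 where inter: "\<forall>n\<ge>1. b n \<le> a n \<and> a n < b (Suc n)"
    and a: "D > 0" "\<forall>n>beta i0. [a n = 1] (mod D)"
      "\<forall>g. \<exists>K i2. \<forall>i\<ge>i2. \<forall>U\<subseteq>{beta i<..beta (Suc i)}.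
      \<epsilon> / 4 * real (beta (Suc i) - beta i) \<le> real (card U) \<longrightarrow>
      (\<exists>F\<subseteq>U. sum a F \<le> K * i * 2 ^ i \<and> (\<exists>z. \<forall>l\<le>g. z + l * D\<^sup>2 \<in> subset_sums a F))"
    by blast
  have "eps_complete \<epsilon> a"
    by (rule interlacing_eps_complete[of a D i0]) (use inter a in auto)
  moreover have "\<forall>n\<ge>1. 0 < a n" using inter pos by (metis order_less_le_trans)
  ultimately show ?thesis using inter by blast
qed

end
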